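(* Let $S$ be a right reversible semitopological semigroup such that $\operatorname{LUC}(S)$ has a left invariant mean. Let $(X,d)$ be a Fréchet space with a ``good'' metric $d$, and let $\tau$ be a $d$-admissible locally convex topology of $X$. Let $K$ be a nonempty, $d$-separable, $\tau$-compact and convex subset of $X$. Then every super asymptotically $d$-nonexpansive and jointly $\tau$-continuous action $S\times K\to K$ has a common fixed point, i.e. there is $x_0\in K$ with $s.x_0=x_0$ for all $s\in S$.
   Context: A semitopological semigroup is a semigroup $S$ with a Hausdorff topology such that for each fixed $t\in S$ the maps $s\mapsto ts$ and $s\mapsto st$ are continuous. A left ideal is a nonempty subset $I\subseteq S$ with $SI\subseteq I$. $S$ is right reversible if any two closed left ideals of $S$ intersect. $\operatorname{CB}(S)$ is the Banach space of bounded continuous real-valued functions on $S$ with the supremum norm. For $s\in S$, $(l_sf)(t)=f(st)$. $\operatorname{LUC}(S)$ is the space of all $f\in \operatorname{CB}(S)$ for which $s\mapsto l_sf$ from $S$ into $\operatorname{CB}(S)$ is norm continuous. A left invariant mean on $\operatorname{LUC}(S)$ is a functional $m\in \operatorname{LUC}(S)^*$ with $\|m\|=m(1)=1$ and $m(l_sf)=m(f)$ for all $s\in S$, $f\in\operatorname{LUC}(S)$. An action of $S$ on $K$ is a map $S\times K\to K$, $(s,x)\mapsto s.x$, with $(st).x=s.(t.x)$. It is jointly $\tau$-continuous if this map is jointly continuous when $K$ carries the topology $\tau$. It is super asymptotically $d$-nonexpansive if for each $x\in K$ and $t\in S$ there is a left ideal $I_x^t$ of $S$ such that $d(st.x,st.y)\le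 d(x,y)$ for all $y\in K$ and all $s\in I_x^t$. Locally convex topologies are Hausdorff. A Fréchet space is a complete metrizable locally convex space. A metric $d$ defining the topology of $X$ is ``good'' if $d(x+y,x+z)=d(y,z)$ for all $x,y,z\in X$ and every ball $B_r(0)=\{x\in X:d(x,0)<r\}$, $r>0$, is open and absolutely convex. A locally convex topology $\tau$ on $X$ is $d$-admissible if $\tau$ is weaker than the $d$-topology and the metric $d$ is $\tau$-lower semicontinuous. *)

theory Defs
  imports "HOL-Analysis.Analysis"
begin

text \<open>Separate continuity of the multiplication. The axioms are phrased with open preimages
  because \<open>continuous_on\<close> is not available inside the class specification.\<close>

class semitopological_semigroup = semigroup_mult + t2_space +
  assumes open_vimage_mult_left: "open U \<Longrightarrow> open ((\<lambda>s. t * s) -` U)"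
    and open_vimage_mult_right: "open U \<Longrightarrow> open ((\<lambda>s. s * t) -` U)"

lemma continuous_mult_left: "continuous_on UNIV (\<lambda>s::'s::semitopological_semigroup. t * s)"
  by (simp add: continuous_on_open_vimage open_vimage_mult_left)

lemma continuous_mult_right: "continuous_on UNIV (\<lambda>s::'s::semitopological_semigroup. s * t)"
  by (simp add: continuous_on_open_vimage open_vimage_mult_right)

definition left_ideal :: "'s::semigroup_mult set \<Rightarrow> bool"
  where "left_ideal I \<longleftrightarrow> I \<noteq> {} \<and> (\<forall>s. \<forall>x\<in>I. s * x \<in> I)"

definition right_reversible :: "'s::semitopological_semigroup itself \<Rightarrow> bool"
  where "right_reversible _ \<longleftrightarrow>
    (\<forall>I J :: 's set. closed I \<and> left_ideal I \<and> closed J \<and> left_ideal J \<longrightarrow> I \<inter> J \<noteq> {})"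

definition left_translate ::
  "'s::semitopological_semigroup \<Rightarrow> ('s \<Rightarrow>\<^sub>C real) \<Rightarrow> ('s \<Rightarrow>\<^sub>C real)"
  where "left_translate s f = Bcontfun (\<lambda>t. apply_bcontfun f (s * t))"

lemma left_translate_apply [simp]:
  "apply_bcontfun (left_translate s f) t = apply_bcontfun f (s * t)"
proof -
  have f: "apply_bcontfun f \<in> bcontfun"
    by (rule apply_bcontfun)
  have "continuous_on UNIV (\<lambda>t. apply_bcontfun f (s * t))"
    using f by (intro continuous_on_compose2[of UNIV "apply_bcontfun f" UNIV "\<lambda>t. s * t"]
        continuous_mult_left) (auto simp: bcontfun_def)
  moreover have "bounded (range (\<lambda>t. apply_bcontfun f (s * t)))"
    by (rule bounded_subset[of "range (apply_bcontfun f)"]) (use f in \<open>auto simp: bcontfun_def\<close>)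
  ultimately have "(\<lambda>t. apply_bcontfun f (s * t)) \<in> bcontfun"
    by (auto simp: bcontfun_def)
  then show ?thesis
    by (simp add: left_translate_def Bcontfun_inverse)
qed

definition LUC :: "('s::semitopological_semigroup \<Rightarrow>\<^sub>C real) set"
  where "LUC = {f. continuous_on UNIV (\<lambda>s. left_translate s f)}"

text \<open>Functionals on a linear subspace \<open>V\<close> are modelled by functions on the whole space of
  which only the values on \<open>V\<close> matter.\<close>

definition in_dual :: "'v::real_normed_vector set \<Rightarrow> ('v \<Rightarrow> real) \<Rightarrow> bool"
  where "in_dual V m \<longleftrightarrow>
    (\<forall>f\<in>V. \<forall>g\<in>V. m (f + g) = m f + m g) \<and>
    (\<forall>c. \<forall>f\<in>V. m (c *\<^sub>R f) = c * m f) \<and>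
    (\<exists>B. \<forall>f\<in>V. \<bar>m f\<bar> \<le> B * norm f)"

definition dual_norm :: "'v::real_normed_vector set \<Rightarrow> ('v \<Rightarrow> real) \<Rightarrow> real"
  where "dual_norm V m = (SUP f\<in>{f\<in>V. norm f \<le> 1}. \<bar>m f\<bar>)"

definition left_invariant_mean ::
  "(('s::semitopological_semigroup \<Rightarrow>\<^sub>C real) \<Rightarrow> real) \<Rightarrow> bool"
  where "left_invariant_mean m \<longleftrightarrow>
    in_dual LUC m \<and> dual_norm LUC m = 1 \<and> m (const_bcontfun 1) = 1 \<and>
    (\<forall>s. \<forall>f\<in>LUC. m (left_translate s f) = m f)"

definition locally_convex_topology :: "'x::real_vector topology \<Rightarrow> bool"
  where "locally_convex_topology T \<longleftrightarrow>
    topspace T = UNIV \<and>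
    Hausdorff_space T \<and>
    continuous_map (prod_topology T T) T (\<lambda>(x, y). x + y) \<and>
    continuous_map (prod_topology euclideanreal T) T (\<lambda>(c, x). c *\<^sub>R x) \<and>
    (\<forall>U. openin T U \<and> 0 \<in> U \<longrightarrow> (\<exists>V. openin T V \<and> 0 \<in> V \<and> convex V \<and> V \<subseteq> U))"

abbreviation metric_topology :: "('x \<Rightarrow> 'x \<Rightarrow> real) \<Rightarrow> 'x topology"
  where "metric_topology d \<equiv> Metric_space.mtopology UNIV d"

text \<open>Completeness is that of \<open>d\<close> itself. For a translation-invariant \<open>d\<close>, as in all uses below,
  the \<open>d\<close>-Cauchy sequences are those of the topological vector space, so this is completeness
  of the vector topology.\<close>

definition Frechet_space :: "('x::real_vector \<Rightarrow> 'x \<Rightarrow> real) \<Rightarrow> bool"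
  where "Frechet_space d \<longleftrightarrow>
    Metric_space UNIV d \<and> Metric_space.mcomplete UNIV d \<and>
    locally_convex_topology (metric_topology d)"

definition absolutely_convex :: "'x::real_vector set \<Rightarrow> bool"
  where "absolutely_convex B \<longleftrightarrow>
    (\<forall>x\<in>B. \<forall>y\<in>B. \<forall>a b. \<bar>a\<bar> + \<bar>b\<bar> \<le> 1 \<longrightarrow> a *\<^sub>R x + b *\<^sub>R y \<in> B)"

definition good_metric :: "('x::real_vector \<Rightarrow> 'x \<Rightarrow> real) \<Rightarrow> bool"
  where "good_metric d \<longleftrightarrow>
    (\<forall>x y z. d (x + y) (x + z) = d y z) \<and>
    (\<forall>r>0. openin (metric_topology d) {x. d x 0 < r} \<and> absolutely_convex {x. d x 0 < r})"

definition lower_semicontinuous :: "'a topology \<Rightarrow> ('a \<Rightarrow> real) \<Rightarrow> bool"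
  where "lower_semicontinuous T f \<longleftrightarrow> (\<forall>r. openin T {x \<in> topspace T. r < f x})"

definition admissible :: "('x::real_vector \<Rightarrow> 'x \<Rightarrow> real) \<Rightarrow> 'x topology \<Rightarrow> bool"
  where "admissible d T \<longleftrightarrow>
    (\<forall>U. openin T U \<longrightarrow> openin (metric_topology d) U) \<and>
    lower_semicontinuous (prod_topology T T) (\<lambda>(x, y). d x y)"

definition semigroup_action :: "'x set \<Rightarrow> ('s::semigroup_mult \<Rightarrow> 'x \<Rightarrow> 'x) \<Rightarrow> bool"
  where "semigroup_action K act \<longleftrightarrow>
    (\<forall>s. \<forall>x\<in>K. act s x \<in> K) \<and>
    (\<forall>s t. \<forall>x\<in>K. act (s * t) x = act s (act t x))"

definition jointly_continuous_action ::
  "'x topology \<Rightarrow> 'x set \<Rightarrow> ('s::topological_space \<Rightarrow> 'x \<Rightarrow> 'x) \<Rightarrow> bool"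
  where "jointly_continuous_action T K act \<longleftrightarrow>
    continuous_map (prod_topology euclidean (subtopology T K)) (subtopology T K)
      (\<lambda>(s, x). act s x)"

definition super_asymptotically_nonexpansive ::
  "('x \<Rightarrow> 'x \<Rightarrow> real) \<Rightarrow> 'x set \<Rightarrow> ('s::semigroup_mult \<Rightarrow> 'x \<Rightarrow> 'x) \<Rightarrow> bool"
  where "super_asymptotically_nonexpansive d K act \<longleftrightarrow>
    (\<forall>x\<in>K. \<forall>t. \<exists>I. left_ideal I \<and>
      (\<forall>y\<in>K. \<forall>s\<in>I. d (act (s * t) x) (act (s * t) y) \<le> d x y))"

end

theory Submission
  imports Defs
begin

text \<open>Right reversibility makes the closed left ideals directed, so every \<open>z \<in> K\<close> has a limit set
  \<open>L(z) = \<Inter>\<^sub>J cl(J z)\<close>, which is nonempty, closed and invariant. Let \<open>C\<close> be minimal among the nonempty closed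
  convex sets containing the limit sets of their points, and let \<open>X \<subseteq> C\<close> be a minimal closed invariant set.
  The invariant mean gives \<open>s X = X\<close> for all \<open>s\<close>, and with separability and the Baire category theorem \<open>X\<close> is
  totally bounded for \<open>d\<close>. If \<open>X\<close> had two points, a normal structure argument would produce a smaller set
  than \<open>C\<close>. The sup-distance to \<open>X\<close> does not serve for this: balls of a good metric need not be
  homothetic, and with \<open>d x y = min \<bar>x - y\<bar> 1\<close> no point of a long interval is closer to the whole interval than
  its diameter. Instead, distances are measured by the number \<open>k\<close> of steps in sets \<open>B\<^sub>r + k B\<^sub>c\<close> with \<open>r\<close> fixed and
  \<open>c\<close> so small that \<open>k\<close> has to exceed the size of an \<open>r\<close>-net of \<open>X\<close>; then the barycentre of the net saves
  one step.\<close>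

subsection \<open>Invariant means and minimal sets\<close>

text \<open>Compactness bounds chains from below: a finite subfamily of a chain contains its own
  intersection, so the finite intersection property applies. The lemma serves both the minimal
  invariant sets and the minimal \<open>stable\<close> sets.\<close>

lemma minimal_closed_set:
  assumes "compact_space T" and A0: "A0 \<in> \<A>"
    and closed: "\<And>A. A \<in> \<A> \<Longrightarrow> closedin T A \<and> A \<noteq> {}"
    and inter: "\<And>\<C>. \<C> \<noteq> {} \<Longrightarrow> \<C> \<subseteq> \<A> \<Longrightarrow> \<Inter>\<C> \<noteq> {} \<Longrightarrow> \<Inter>\<C> \<in> \<A>"
  obtains M where "M \<in> \<A>" "\<And>A. A \<in> \<A> \<Longrightarrow> A \<subseteq> M \<Longrightarrow> A = M"
proof -
  \<comment> \<open>Zorn's lemma yields maximal elements, hence the passage to complements.\<close>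
  have "\<exists>M\<in>uminus ` \<A>. \<forall>X\<in>uminus ` \<A>. M \<subseteq> X \<longrightarrow> X = M"
  proof (rule subset_Zorn_nonempty)
    show "uminus ` \<A> \<noteq> {}"
      using A0 by blast
    fix \<C> assume "\<C> \<noteq> {}" and chain: "subset.chain (uminus ` \<A>) \<C>"
    define \<D> where "\<D> = uminus ` \<C>"
    have C: "\<C> = uminus ` \<D>"
      by (auto simp: \<D>_def image_image)
    have D: "\<D> \<noteq> {}" "\<D> \<subseteq> \<A>"
      using \<open>\<C> \<noteq> {}\<close> chain by (auto simp: \<D>_def subset_chain_def)
    have comparable: "A \<subseteq> B \<or> B \<subseteq> A" if "A \<in> \<D>" "B \<in> \<D>" for A B
    proof -
      have "- A \<in> \<C>" "- B \<in> \<C>"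
        using that C by auto
      then have "- A \<subseteq> - B \<or> - B \<subseteq> - A"
        using chain unfolding subset_chain_def by blast
      then show ?thesis
        by auto
    qed
    have "\<Inter>\<F> \<noteq> {}" if "finite \<F>" "\<F> \<subseteq> \<D>" for \<F>
    proof (cases "\<F> = {}")
      case False
      have "\<Inter>\<F> \<in> \<F>"
        using that(1) False that(2)
      proof (induction rule: finite_ne_induct)
        case (insert A \<F>)
        then have "\<Inter>\<F> \<in> \<F>" "A \<in> \<D>" "\<F> \<subseteq> \<D>"
          by simp_all
        then have "A \<subseteq> \<Inter>\<F> \<or> \<Inter>\<F> \<subseteq> A"
          by (intro comparable) auto
        then have "\<Inter>(insert A \<F>) = A \<or> \<Inter>(insert A \<F>) = \<Inter>\<F>"
          by auto
        then show ?case
          using \<open>\<Inter>\<F> \<in> \<F>\<close> by auto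
      qed auto
      then have "\<Inter>\<F> \<in> \<A>"
        using D that by blast
      then show ?thesis
        using closed by blast
    qed auto
    moreover have "\<forall>A\<in>\<D>. closedin T A"
      using closed D by blast
    ultimately have "\<Inter>\<D> \<noteq> {}"
      using \<open>compact_space T\<close>[unfolded compact_space_fip, rule_format, of \<D>] by blast
    then have "\<Inter>\<D> \<in> \<A>"
      using inter D by blast
    moreover have "\<Union>\<C> = - \<Inter>\<D>"
      by (auto simp: C)
    ultimately show "\<Union>\<C> \<in> uminus ` \<A>"
      by blast
  qed
  then obtain M where "M \<in> \<A>" and M: "\<forall>X\<in>uminus ` \<A>. - M \<subseteq> X \<longrightarrow> X = - M"
    by (elim bexE imageE) simp
  moreover have "A = M" if "A \<in> \<A>" "A \<subseteq> M" for A
    using bspec[OF M imageI[OF that(1)]] that(2) by simp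
  ultimately show ?thesis
    using that by simp
qed

section \<open>Left translations and means on \<open>LUC\<close>\<close>

lemma
  fixes f g :: "'s::semitopological_semigroup \<Rightarrow>\<^sub>C real"
  shows left_translate_add: "left_translate s (f + g) = left_translate s f + left_translate s g"
    and left_translate_scaleR: "left_translate s (c *\<^sub>R f) = c *\<^sub>R left_translate s f"
    and left_translate_const: "left_translate s (const_bcontfun c) = const_bcontfun c"
  by (auto intro!: bcontfun_eqI simp: const_bcontfun.rep_eq)

lemma LUC_add: "f \<in> LUC \<Longrightarrow> g \<in> LUC \<Longrightarrow> f + g \<in> LUC"
  by (simp add: LUC_def left_translate_add continuous_on_add)

lemma LUC_scaleR: "f \<in> LUC \<Longrightarrow> c *\<^sub>R f \<in> LUC"
  by (simp add: LUC_def left_translate_scaleR continuous_on_scaleR)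

lemma LUC_const: "const_bcontfun c \<in> LUC"
  by (simp add: LUC_def left_translate_const)

context
  fixes m :: "('s::semitopological_semigroup \<Rightarrow>\<^sub>C real) \<Rightarrow> real"
  assumes m: "left_invariant_mean m"
begin

lemma mean_add: "f \<in> LUC \<Longrightarrow> g \<in> LUC \<Longrightarrow> m (f + g) = m f + m g"
  and mean_scaleR: "f \<in> LUC \<Longrightarrow> m (c *\<^sub>R f) = c * m f"
  and mean_one: "m (const_bcontfun 1) = 1"
  and mean_translate: "f \<in> LUC \<Longrightarrow> m (left_translate s f) = m f"
  using m by (auto simp: left_invariant_mean_def in_dual_def)

lemma mean_le_one:
  assumes "f \<in> LUC" "norm f \<le> 1"
  shows "m f \<le> 1"
proof -
  obtain B where B: "\<And>f. f \<in> LUC \<Longrightarrow> \<bar>m f\<bar> \<le> B * norm f"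
    using m unfolding left_invariant_mean_def in_dual_def by blast
  \<comment> \<open>The supremum in \<open>dual_norm\<close> dominates its members only once they
    are known to be bounded above, which \<open>in_dual\<close> supplies.\<close>
  have "bdd_above ((\<lambda>f. \<bar>m f\<bar>) ` {f \<in> LUC. norm f \<le> 1})"
  proof (rule bdd_aboveI2)
    fix f :: "'s \<Rightarrow>\<^sub>C real" assume "f \<in> {f \<in> LUC. norm f \<le> 1}"
    then have "\<bar>m f\<bar> \<le> B * norm f" "norm f \<le> 1"
      using B by auto
    then show "\<bar>m f\<bar> \<le> \<bar>B\<bar>"
      by (smt (verit) mult_left_le norm_ge_zero mult_right_mono)
  qed
  then have "\<bar>m f\<bar> \<le> dual_norm LUC m"
    unfolding dual_norm_def by (rule cSUP_upper2) (use assms in auto)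
  then show ?thesis
    using m by (simp add: left_invariant_mean_def)
qed

text \<open>For nonnegative \<open>f\<close> bounded by \<open>c\<close>, the function
  \<open>1 - f / c\<close> has values in the unit interval, so its mean is at most 1.\<close>

lemma mean_nonneg:
  assumes f: "f \<in> LUC" and "\<And>s. 0 \<le> apply_bcontfun f s"
  shows "0 \<le> m f"
proof -
  define c where "c = norm f + 1"
  have c: "c > 0"
    by (simp add: c_def add_nonneg_pos)
  have fc: "apply_bcontfun f s \<le> c" for s
    using norm_bounded[of f s] by (simp add: c_def)
  let ?g = "const_bcontfun 1 + (- 1 / c) *\<^sub>R f"
  have "norm ?g \<le> 1"
    using fc assms(2) c by (intro norm_bound) (auto simp: const_bcontfun.rep_eq abs_le_iff)
  then have "m ?g \<le> 1"
    using f by (intro mean_le_one LUC_add LUC_const LUC_scaleR)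
  moreover have "m ?g = 1 + (- 1 / c) * m f"
    using f by (simp only: mean_add mean_scaleR mean_one LUC_const LUC_scaleR)
  ultimately have "0 \<le> m f / c"
    by simp
  then show ?thesis
    using c by (simp add: zero_le_divide_iff)
qed

lemma mean_ge_const:
  assumes f: "f \<in> LUC" and "\<And>s. c \<le> apply_bcontfun f s"
  shows "c \<le> m f"
proof -
  have eq: "f = c *\<^sub>R const_bcontfun 1 + (f + (- c) *\<^sub>R const_bcontfun 1)"
    by simp
  have "0 \<le> m (f + (- c) *\<^sub>R const_bcontfun 1)"
    using assms by (intro mean_nonneg LUC_add LUC_const LUC_scaleR) (auto simp: const_bcontfun.rep_eq)
  then have "c \<le> m (c *\<^sub>R const_bcontfun 1) + m (f + (- c) *\<^sub>R const_bcontfun 1)"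
    using mean_scaleR[OF LUC_const] mean_one by simp
  also have "\<dots> = m f"
    using f by (subst (2) eq) (intro mean_add[symmetric] LUC_add LUC_const LUC_scaleR)
  finally show ?thesis .
qed

end

section \<open>Jointly continuous actions on compact spaces and their minimal invariant sets\<close>

text \<open>The topology lives on the set acted upon: in the application \<open>T\<close> is \<tau>
  restricted to \<open>K\<close>, with \<open>topspace T = K\<close>.\<close>

locale compact_semigroup_action =
  fixes T :: "'x topology" and act :: "'s::semitopological_semigroup \<Rightarrow> 'x \<Rightarrow> 'x"
  assumes compact: "compact_space T"
    and Hausdorff: "Hausdorff_space T"
    and act_mult: "x \<in> topspace T \<Longrightarrow> act (s * t) x = act s (act t x)"
    and act_continuous: "continuous_map (prod_topology euclidean T) T (\<lambda>(s, x). act s x)"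
begin

definition invariant :: "'x set \<Rightarrow> bool"
  where "invariant X \<longleftrightarrow> (\<forall>s. \<forall>x\<in>X. act s x \<in> X)"

definition minimal_invariant :: "'x set \<Rightarrow> bool"
  where "minimal_invariant X \<longleftrightarrow> closedin T X \<and> X \<noteq> {} \<and> invariant X \<and>
    (\<forall>A. closedin T A \<and> A \<noteq> {} \<and> invariant A \<and> A \<subseteq> X \<longrightarrow> A = X)"

lemma continuous_map_act: "continuous_map T T (act s)"
proof -
  have "continuous_map T (prod_topology euclidean T) (\<lambda>x. (s, x))"
    by (intro continuous_map_pairedI) auto
  from continuous_map_compose[OF this act_continuous] show ?thesis
    by (simp add: o_def)
qed

lemma continuous_map_orbit:
  assumes "x \<in> topspace T"
  shows "continuous_map euclidean T (\<lambda>s. act s x)"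
proof -
  have "continuous_map euclidean (prod_topology euclidean T) (\<lambda>s. (s, x))"
    using assms by (intro continuous_map_pairedI) auto
  from continuous_map_compose[OF this act_continuous] show ?thesis
    by (simp add: o_def)
qed

lemma act_closed: "x \<in> topspace T \<Longrightarrow> act s x \<in> topspace T"
  using continuous_map_act[of s] by (auto simp: continuous_map_def)

lemma minimal_invariant_exists:
  assumes "closedin T L" "L \<noteq> {}" "invariant L"
  obtains X where "minimal_invariant X" "X \<subseteq> L"
proof -
  let ?\<A> = "{A. closedin T A \<and> A \<noteq> {} \<and> invariant A \<and> A \<subseteq> L}"
  obtain X where "X \<in> ?\<A>" "\<And>A. A \<in> ?\<A> \<Longrightarrow> A \<subseteq> X \<Longrightarrow> A = X"
  proof (rule minimal_closed_set[OF compact, of L ?\<A>])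
    fix \<C> assume C: "\<C> \<noteq> {}" "\<C> \<subseteq> ?\<A>" "\<Inter>\<C> \<noteq> {}"
    then have "closedin T (\<Inter>\<C>)"
      by (intro closedin_Inter) auto
    with C show "\<Inter>\<C> \<in> ?\<A>"
      unfolding invariant_def by fastforce
  qed (use assms in auto)
  then show ?thesis
    using that[of X] unfolding minimal_invariant_def by blast
qed

text \<open>Norm continuity of the translates asks that \<open>f (act s z)\<close> be close to
  \<open>f (act s0 z)\<close> uniformly in \<open>z\<close>. Joint continuity and compactness give
  this by the tube lemma, applied to \<open>{s0} \<times> topspace T\<close>.\<close>

lemma LUC_orbit_function:
  assumes f: "continuous_map T euclideanreal f" and x: "x \<in> topspace T"
  obtains F where "F \<in> LUC" "\<And>s. apply_bcontfun F s = f (act s x)"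
proof -
  have "compactin euclideanreal (f ` topspace T)"
    using f compact compact_space_def image_compactin by blast
  then have "bounded (f ` topspace T)"
    by (simp add: compact_imp_bounded)
  then have "bounded (range (\<lambda>s. f (act s x)))"
    by (rule bounded_subset) (use x act_closed in auto)
  moreover have "continuous_on UNIV (\<lambda>s. f (act s x))"
    using continuous_map_compose[OF continuous_map_orbit[OF x] f] by (simp add: o_def)
  ultimately have "(\<lambda>s. f (act s x)) \<in> bcontfun"
    by (simp add: bcontfun_def)
  then obtain F where F: "\<And>s. apply_bcontfun F s = f (act s x)"
    by (metis Bcontfun_inverse)
  have "F \<in> LUC"
    unfolding LUC_def mem_Collect_eq continuous_on_topological
  proof (intro ballI allI impI)
    fix s0 :: 's and B assume "open B" "left_translate s0 F \<in> B"
    then obtain e where e: "e > 0" "ball (left_translate s0 F) e \<subseteq> B"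
      using open_contains_ball by blast
    let ?h = "\<lambda>z. f (act (fst z) (snd z)) - f (act s0 (snd z))"
    have "continuous_map (prod_topology euclidean T) euclideanreal (\<lambda>z. f (act (fst z) (snd z)))"
      using continuous_map_compose[OF act_continuous f] by (simp add: o_def case_prod_beta)
    moreover have "continuous_map (prod_topology euclidean T) euclideanreal (\<lambda>z. f (act s0 (snd z)))"
      using continuous_map_compose[OF continuous_map_compose[OF continuous_map_snd continuous_map_act] f]
      by (simp add: o_def)
    ultimately have "continuous_map (prod_topology euclidean T) euclideanreal ?h"
      by (rule continuous_map_diff)
    then have "openin (prod_topology euclidean T)
        {z \<in> topspace (prod_topology euclidean T). ?h z \<in> {- e / 2 <..< e / 2}}" (is "openin _ ?W")
      by (rule openin_continuous_map_preimage) auto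
    moreover have "{s0} \<times> topspace T \<subseteq> ?W"
      using e by auto
    ultimately obtain U V where UV: "openin euclidean U" "{s0} \<subseteq> U" "topspace T \<subseteq> V" "U \<times> V \<subseteq> ?W"
      using compact by (elim Wallace_theorem_prod_topology[rotated 2]) (auto simp: compact_space_def)
    have "left_translate s F \<in> B" if "s \<in> U" for s
    proof -
      have "dist (left_translate s0 F) (left_translate s F) \<le> e / 2"
      proof (rule dist_bound)
        fix t
        have "(s, act t x) \<in> ?W"
          using UV that act_closed[OF x] by blast
        then have "f (act s (act t x)) - f (act s0 (act t x)) \<in> {- e / 2 <..< e / 2}"
          by simp
        then show "dist (apply_bcontfun (left_translate s0 F) t) (apply_bcontfun (left_translate s F) t) \<le> e / 2"
          by (simp only: left_translate_apply F act_mult[OF x] dist_real_def greaterThanLessThan_iff) linarith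
      qed
      then show ?thesis
        using e by auto
    qed
    then show "\<exists>A. open A \<and> s0 \<in> A \<and> (\<forall>y\<in>UNIV. y \<in> A \<longrightarrow> left_translate y F \<in> B)"
      using UV by (intro exI[of _ U]) auto
  qed
  then show ?thesis
    using F that by blast
qed

text \<open>The support of the invariant functional \<open>f \<mapsto> m (\<lambda>s. f (s x\<^sub>0))\<close> is all of \<open>X\<close> by minimality,
  and it is contained in every translate of \<open>X\<close>.\<close>

lemma minimal_invariant_image:
  assumes m: "\<exists>m :: ('s \<Rightarrow>\<^sub>C real) \<Rightarrow> real. left_invariant_mean m" and X: "minimal_invariant X"
  shows "act s ` X = X"
proof
  obtain m :: "('s \<Rightarrow>\<^sub>C real) \<Rightarrow> real" where m: "left_invariant_mean m"
    using m by blast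
  have closed: "closedin T X" and "X \<noteq> {}" and inv: "invariant X"
    and minimal: "\<And>A. closedin T A \<Longrightarrow> A \<noteq> {} \<Longrightarrow> invariant A \<Longrightarrow> A \<subseteq> X \<Longrightarrow> A = X"
    using X by (auto simp: minimal_invariant_def)
  have XT: "X \<subseteq> topspace T"
    using closed closedin_subset by blast
  have compactX: "compactin T X"
    using closed compact closedin_compact_space by blast
  obtain x0 where x0: "x0 \<in> X" "x0 \<in> topspace T"
    using \<open>X \<noteq> {}\<close> XT by blast
  have "\<exists>F. F \<in> LUC \<and> (\<forall>s. apply_bcontfun F s = f (act s x0))"
    if "continuous_map T euclideanreal f" for f
    using LUC_orbit_function[OF that x0(2)] by blast
  then obtain lift where lift: "lift f \<in> LUC" "apply_bcontfun (lift f) t = f (act t x0)"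
    if "continuous_map T euclideanreal f" for f t
    by metis
  \<comment> \<open>The nonnegative functions annihilated by the functional
    \<open>f \<mapsto> m (lift f)\<close>; their common zero set \<open>M\<close> in
    \<open>X\<close> is its support.\<close>
  define \<N> where "\<N> = {f. continuous_map T euclideanreal f \<and> (\<forall>x\<in>topspace T. 0 \<le> f x) \<and> m (lift f) = 0}"
  define M where "M = {x \<in> X. \<forall>f\<in>\<N>. f x = 0}"
  have "closedin T M"
  proof -
    have "closedin T {x \<in> topspace T. f x = 0}" if "f \<in> \<N>" for f
      using that closedin_continuous_map_preimage[of T euclideanreal f "{0}"] by (simp add: \<N>_def)
    then have "closedin T (\<Inter>(insert X ((\<lambda>f. {x \<in> topspace T. f x = 0}) ` \<N>)))"
      using closed by (intro closedin_Inter) auto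
    also have "\<Inter>(insert X ((\<lambda>f. {x \<in> topspace T. f x = 0}) ` \<N>)) = M"
      using XT by (auto simp: M_def)
    finally show ?thesis .
  qed
  moreover have "invariant M"
    unfolding invariant_def
  proof (intro allI ballI)
    fix s x assume x: "x \<in> M"
    have "f (act s x) = 0" if f: "f \<in> \<N>" for f
    proof -
      have cont: "continuous_map T euclideanreal f" 
        using f by (simp add: \<N>_def)
      have cont': "continuous_map T euclideanreal (\<lambda>y. f (act s y))"
        using continuous_map_compose[OF continuous_map_act cont] by (simp add: o_def)
      \<comment> \<open>Left invariance of the mean makes \<open>\<N>\<close> stable under
        composition with \<open>act s\<close>, which is invariance of \<open>M\<close>.\<close>
      have "lift (\<lambda>y. f (act s y)) = left_translate s (lift f)"
        by (rule bcontfun_eqI) (simp add: lift[OF cont] lift[OF cont'] act_mult[OF x0(2)])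
      then have "(\<lambda>y. f (act s y)) \<in> \<N>"
        using f cont' mean_translate[OF m lift(1)[OF cont]] act_closed by (simp add: \<N>_def)
      then show ?thesis
        using x by (auto simp: M_def)
    qed
    then show "act s x \<in> M"
      using x inv by (auto simp: M_def invariant_def)
  qed
  moreover have "M \<noteq> {}"
  proof
    \<comment> \<open>By compactness finitely many members of \<open>\<N>\<close> would then have a
      sum \<open>g\<close> that is positive on \<open>X\<close>. Its mean is 0, yet it is at least
      the minimum of \<open>g\<close> on \<open>X\<close>, because the orbit of \<open>x0\<close>
      stays in \<open>X\<close>.\<close>
    assume "M = {}"
    let ?U = "\<lambda>f. {x \<in> topspace T. f x \<in> {0<..}}"
    have "X \<subseteq> \<Union>(?U ` \<N>)"
    proof
      fix x assume x: "x \<in> X"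
      then obtain f where "f \<in> \<N>" "f x \<noteq> 0"
        using \<open>M = {}\<close> by (auto simp: M_def)
      moreover have "0 \<le> f x"
        using \<open>f \<in> \<N>\<close> x XT by (auto simp: \<N>_def)
      ultimately show "x \<in> \<Union>(?U ` \<N>)"
        using x XT by (intro UN_I[of f]) auto
    qed
    moreover have "openin T (?U f)" if "f \<in> \<N>" for f
      using that by (intro openin_continuous_map_preimage) (auto simp: \<N>_def)
    ultimately obtain \<U> where U: "finite \<U>" "\<U> \<subseteq> ?U ` \<N>" "X \<subseteq> \<Union>\<U>"
      using compactinD[OF compactX, of "?U ` \<N>"] by blast
    obtain \<F> where "\<F> \<subseteq> \<N>" "finite \<F>" "\<U> = ?U ` \<F>"
      using finite_subset_image[OF U(1,2)] by blast
    with U(3) have F: "finite \<F>" "\<F> \<subseteq> \<N>" "X \<subseteq> \<Union>(?U ` \<F>)"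
      by simp_all
    define g where "g x = (\<Sum>f\<in>\<F>. f x)" for x
    have contF: "continuous_map T euclideanreal f" if "f \<in> \<F>" for f
      using that F by (auto simp: \<N>_def)
    have contg: "continuous_map T euclideanreal g"
      unfolding g_def using F contF by (intro continuous_map_sum) auto
    have "m (lift (\<lambda>x. \<Sum>f\<in>\<G>. f x)) = 0" if "finite \<G>" "\<G> \<subseteq> \<F>" for \<G>
      using that
    proof (induction \<G>)
      case empty
      have "lift (\<lambda>x. 0) = 0 *\<^sub>R const_bcontfun 1"
        by (rule bcontfun_eqI) (simp add: lift)
      then have "m (lift (\<lambda>x. 0)) = 0"
        using mean_scaleR[OF m LUC_const, of 0 1] by simp
      then show ?case
        by simp
    next
      case (insert h \<G>)
      have cont: "continuous_map T euclideanreal (\<lambda>x. \<Sum>f\<in>\<G>. f x)"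
        using insert contF by (intro continuous_map_sum) auto
      have cont': "continuous_map T euclideanreal (\<lambda>x. \<Sum>f\<in>insert h \<G>. f x)"
        using insert contF by (intro continuous_map_sum) auto
      have conth: "continuous_map T euclideanreal h"
        using insert contF by auto
      have "lift (\<lambda>x. \<Sum>f\<in>insert h \<G>. f x) = lift h + lift (\<lambda>x. \<Sum>f\<in>\<G>. f x)"
        by (rule bcontfun_eqI, subst lift(2)[OF cont'])
          (simp add: lift(2)[OF cont] lift(2)[OF conth] insert.hyps)
      moreover have "m (lift h) = 0"
        using insert.prems F(2) by (auto simp: \<N>_def)
      moreover have "m (lift (\<lambda>x. \<Sum>f\<in>\<G>. f x)) = 0"
        using insert.IH insert.prems by blast
      ultimately show ?case
        using mean_add[OF m lift(1)[OF conth] lift(1)[OF cont]] by simp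
    qed
    from this[OF F(1) subset_refl] have mg: "m (lift g) = 0"
      by (simp only: g_def[abs_def])
    have gpos: "0 < g x" if "x \<in> X" for x
    proof -
      obtain f where f: "f \<in> \<F>" "0 < f x"
        using subsetD[OF F(3) \<open>x \<in> X\<close>] by auto
      have "0 \<le> h x" if "h \<in> \<F>" for h
        using that F(2) \<open>x \<in> X\<close> XT by (auto simp: \<N>_def)
      then show ?thesis
        unfolding g_def using F(1) f by (intro sum_pos2[of _ f]) auto
    qed
    have "compact (g ` X)"
      using image_compactin[OF compactX contg] by simp
    then obtain c where c: "c \<in> g ` X" "\<And>y. y \<in> g ` X \<Longrightarrow> c \<le> y"
      using compact_attains_inf[of "g ` X"] \<open>X \<noteq> {}\<close> by blast
    have "c \<le> m (lift g)"
      using c inv x0 by (intro mean_ge_const[OF m lift(1)[OF contg]]) (auto simp: lift[OF contg] invariant_def)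
    then show False
      using c gpos mg by force
  qed
  ultimately have MX: "M = X"
    using minimal by (auto simp: M_def)
  show "act s ` X \<subseteq> X"
    using inv by (auto simp: invariant_def)
  show "X \<subseteq> act s ` X"
  proof
    fix y assume y: "y \<in> X"
    show "y \<in> act s ` X"
    proof (rule ccontr)
      assume "y \<notin> act s ` X"
      moreover have "closedin T (act s ` X)"
        using image_compactin[OF compactX continuous_map_act] Hausdorff compactin_imp_closedin by blast
      moreover have "closedin T {y}"
        using y XT Hausdorff by (intro compactin_imp_closedin) auto
      moreover have "normal_space T"
        using compact Hausdorff compact_Hausdorff_or_regular_imp_normal_space by blast
      ultimately obtain f where f: "continuous_map T (top_of_set {0..1::real}) f" "f ` (act s ` X) \<subseteq> {0}" "f ` {y} \<subseteq> {1}"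
        using Urysohn_lemma[of T "act s ` X" "{y}" 0 1] by (auto simp: disjnt_def)
      have cont: "continuous_map T euclideanreal f" and nonneg: "\<forall>x\<in>topspace T. 0 \<le> f x"
        using f(1) by (auto simp: continuous_map_in_subtopology)
      have "f (act s (act t x0)) = 0" for t
        using f(2) inv x0 unfolding invariant_def by blast
      then have "left_translate s (lift f) = 0 *\<^sub>R const_bcontfun 1"
        by (intro bcontfun_eqI) (simp add: lift[OF cont] act_mult[OF x0(2)])
      then have "m (lift f) = 0"
        using mean_translate[OF m lift(1)[OF cont], of s] mean_scaleR[OF m LUC_const, of 0 1] by simp
      then have "f \<in> \<N>"
        using cont nonneg by (simp add: \<N>_def)
      then have "f y = 0"
        using y MX unfolding M_def by blast
      then show False
        using f(3) by simp
    qed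
  qed
qed

end

subsection \<open>Asymptotically nonexpansive actions on compact spaces\<close>

definition closed_left_ideal :: "'s::semitopological_semigroup set \<Rightarrow> bool"
  where "closed_left_ideal J \<longleftrightarrow> closed J \<and> left_ideal J"

lemma closed_left_ideal_closure:
  fixes I :: "'s::semitopological_semigroup set"
  assumes "left_ideal I"
  shows "closed_left_ideal (closure I)"
proof -
  have "s * x \<in> closure I" if "x \<in> closure I" for s x
  proof -
    have "(\<lambda>x. s * x) ` closure I \<subseteq> closure I"
      using assms by (intro image_closure_subset[OF continuous_on_subset[OF continuous_mult_left]])
        (auto simp: left_ideal_def intro!: subsetD[OF closure_subset])
    then show ?thesis
      using that by auto
  qed
  then show ?thesis
    using assms by (auto simp: closed_left_ideal_def left_ideal_def)
qed

lemma left_ideal_mult_right: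
  assumes "left_ideal I"
  shows "left_ideal ((\<lambda>s. s * t) ` I)"
  using assms by (auto simp: left_ideal_def mult.assoc[symmetric])

text \<open>This is how right reversibility enters: finitely many conditions, each valid on a closed
  left ideal, hold together on one. The empty family yields the whole semigroup.\<close>

lemma closed_left_ideal_Int_finite:
  fixes \<J> :: "'s::semitopological_semigroup set set"
  assumes "right_reversible TYPE('s)" "finite \<J>" "\<And>J. J \<in> \<J> \<Longrightarrow> closed_left_ideal J"
  shows "closed_left_ideal (\<Inter>\<J>)"
  using assms(2,3)
proof (induction \<J>)
  case empty
  then show ?case
    by (simp add: closed_left_ideal_def left_ideal_def)
next
  case (insert J \<J>)
  then have J: "closed_left_ideal J" "closed_left_ideal (\<Inter>\<J>)"
    by simp_all
  then have "J \<inter> \<Inter>\<J> \<noteq> {}"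
    using assms(1) unfolding right_reversible_def closed_left_ideal_def by blast
  with J have "closed_left_ideal (J \<inter> \<Inter>\<J>)"
    by (auto simp: closed_left_ideal_def left_ideal_def)
  then show ?case
    by simp
qed

section \<open>Ideals of nonexpansiveness\<close>

locale nonexpansive_action =
  compact_semigroup_action T act + Metric_space "topspace T" d
  for T :: "'x topology" and act :: "'s::semitopological_semigroup \<Rightarrow> 'x \<Rightarrow> 'x"
    and d :: "'x \<Rightarrow> 'x \<Rightarrow> real" +
  assumes closedin_dist_le: "closedin (prod_topology T T) {z \<in> topspace T \<times> topspace T. d (fst z) (snd z) \<le> c}"
    and reversible: "right_reversible TYPE('s)"
    and nonexpansive: "super_asymptotically_nonexpansive d (topspace T) act"
begin

text \<open>Lower semicontinuity of \<open>d\<close> lets an estimate valid on a left ideal pass to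
  its closure.\<close>

lemma closed_dist_le:
  assumes "x \<in> topspace T" "y \<in> topspace T"
  shows "closed {s. d (act s x) (act s y) \<le> c}"
proof -
  have "continuous_map euclidean (prod_topology T T) (\<lambda>s. (act s x, act s y))"
    using assms by (intro continuous_map_pairedI continuous_map_orbit)
  from closedin_continuous_map_preimage[OF this closedin_dist_le[of c]] show ?thesis
    using assms act_closed by simp
qed

lemma closedin_cball:
  assumes "x \<in> topspace T"
  shows "closedin T {y \<in> topspace T. d x y \<le> c}"
proof -
  have "continuous_map T (prod_topology T T) (\<lambda>y. (x, y))"
    using assms by (intro continuous_map_pairedI) auto
  from closedin_continuous_map_preimage[OF this closedin_dist_le[of c]] show ?thesis
    using assms by (simp add: Collect_conj_eq Int_commute conj_ac cong: conj_cong)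
qed

text \<open>With an arbitrary \<open>t\<close> fixed, the products \<open>s * t\<close> with
  \<open>s\<close> in the ideal given for \<open>x\<close> and \<open>t\<close> form a left ideal;
  its closure inherits the estimate.\<close>

lemma nonexpansive_ideal:
  assumes x: "x \<in> topspace T"
  obtains J where "closed_left_ideal J"
    "\<And>s y. s \<in> J \<Longrightarrow> y \<in> topspace T \<Longrightarrow> d (act s x) (act s y) \<le> d x y"
proof -
  fix t :: 's
  obtain I where I: "left_ideal I"
      "\<And>s y. s \<in> I \<Longrightarrow> y \<in> topspace T \<Longrightarrow> d (act (s * t) x) (act (s * t) y) \<le> d x y"
    using nonexpansive x unfolding super_asymptotically_nonexpansive_def by meson
  let ?J = "closure ((\<lambda>s. s * t) ` I)"
  have "d (act s x) (act s y) \<le> d x y" if "s \<in> ?J" "y \<in> topspace T" for s y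
  proof -
    have "?J \<subseteq> {s. d (act s x) (act s y) \<le> d x y}"
      using I that x by (intro closure_minimal closed_dist_le) auto
    then show ?thesis
      using that by blast
  qed
  then show ?thesis
    using that[of ?J] I(1) by (simp add: closed_left_ideal_closure left_ideal_mult_right)
qed

lemma nonexpansive_ideal_finite:
  assumes "finite F" "F \<subseteq> topspace T"
  obtains J where "closed_left_ideal J"
    "\<And>s x y. s \<in> J \<Longrightarrow> x \<in> F \<Longrightarrow> y \<in> topspace T \<Longrightarrow> d (act s x) (act s y) \<le> d x y"
proof -
  have "\<exists>J. closed_left_ideal J \<and> (\<forall>s\<in>J. \<forall>y\<in>topspace T. d (act s x) (act s y) \<le> d x y)" if "x \<in> F" for x
  proof -
    have "x \<in> topspace T"
      using that assms(2) by blast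
    then show ?thesis
      by (rule nonexpansive_ideal) blast
  qed
  then obtain J where J: "closed_left_ideal (J x)"
      "\<forall>s\<in>J x. \<forall>y\<in>topspace T. d (act s x) (act s y) \<le> d x y" if "x \<in> F" for x
    by metis
  have "closed_left_ideal (\<Inter>(J ` F))"
    using J assms by (intro closed_left_ideal_Int_finite[OF reversible]) auto
  then show ?thesis
    using J(2) by (intro that[of "\<Inter>(J ` F)"]) auto
qed

section \<open>Limit sets of orbits\<close>

text \<open>The closed left ideals are directed downwards and act as tails; these are the cluster
  points of the orbit of \<open>x\<close> along them.\<close>

definition limit_set :: "'x \<Rightarrow> 'x set"
  where "limit_set x = \<Inter>{T closure_of ((\<lambda>s. act s x) ` J) |J. closed_left_ideal J}"

lemma closed_left_ideal_UNIV: "closed_left_ideal (UNIV :: 's set)"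
  by (simp add: closed_left_ideal_def left_ideal_def)

lemma closedin_limit_set: "closedin T (limit_set x)"
  unfolding limit_set_def using closed_left_ideal_UNIV by (intro closedin_Inter) auto

lemma invariant_limit_set:
  assumes x: "x \<in> topspace T"
  shows "invariant (limit_set x)"
  unfolding invariant_def
proof (intro allI ballI)
  fix s y assume y: "y \<in> limit_set x"
  have "act s y \<in> T closure_of ((\<lambda>s. act s x) ` J)" if J: "closed_left_ideal J" for J
  proof -
    have "act s y \<in> act s ` (T closure_of ((\<lambda>s. act s x) ` J))"
      using y J by (auto simp: limit_set_def)
    also have "\<dots> \<subseteq> T closure_of (act s ` ((\<lambda>s. act s x) ` J))"
      by (rule continuous_map_image_closure_subset[OF continuous_map_act])
    also have "\<dots> \<subseteq> T closure_of ((\<lambda>s. act s x) ` J)"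
      using J by (intro closure_of_mono) (auto simp: act_mult[OF x, symmetric] closed_left_ideal_def left_ideal_def)
    finally show ?thesis .
  qed
  then show "act s y \<in> limit_set x"
    by (auto simp: limit_set_def)
qed

text \<open>A common element \<open>s\<close> of finitely many closed left ideals puts
  \<open>act s x\<close> into all the corresponding closures, so the finite intersection property
  applies.\<close>

lemma limit_set_nonempty:
  assumes x: "x \<in> topspace T"
  shows "limit_set x \<noteq> {}"
proof -
  let ?C = "\<lambda>J. T closure_of ((\<lambda>s. act s x) ` J)"
  have "\<Inter>\<F> \<noteq> {}" if F: "finite \<F>" "\<F> \<subseteq> {?C J |J. closed_left_ideal J}" for \<F>
  proof -
    have "\<F> \<subseteq> ?C ` Collect closed_left_ideal"
      using F(2) by auto
    then obtain \<J> where J: "\<J> \<subseteq> Collect closed_left_ideal" "finite \<J>" "\<F> = ?C ` \<J>"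
      using finite_subset_image[OF F(1)] by blast
    have "closed_left_ideal (\<Inter>\<J>)"
      using J by (intro closed_left_ideal_Int_finite[OF reversible]) auto
    then obtain s where s: "s \<in> \<Inter>\<J>"
      by (auto simp: closed_left_ideal_def left_ideal_def)
    have "act s x \<in> ?C J" if "J \<in> \<J>" for J
      using s that act_closed[OF x] by (intro subsetD[OF closure_of_subset]) auto
    then show ?thesis
      using J(3) by auto
  qed
  then show ?thesis
    using compact unfolding compact_space_fip limit_set_def by (elim allE impE) auto
qed

text \<open>By the Baire category theorem some nonempty relatively open subset of \<open>X\<close> has small diameter;
  by minimality finitely many of its preimages cover \<open>X\<close>, and a limit of products turns these
  into a cover of \<open>X = r X\<close> by sets of small diameter.\<close>

lemma minimal_invariant_totally_bounded:
  assumes X: "minimal_invariant X" and image: "\<And>s. act s ` X = X"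
    and Q: "countable Q" "Q \<subseteq> topspace T" "\<And>x e. x \<in> X \<Longrightarrow> e > 0 \<Longrightarrow> \<exists>q\<in>Q. d q x < e"
    and "e > 0"
  shows "\<exists>F. finite F \<and> F \<subseteq> X \<and> (\<forall>x\<in>X. \<exists>y\<in>F. d y x \<le> e)"
proof -
  have closed: "closedin T X" and "X \<noteq> {}" and inv: "invariant X"
    and minimal: "\<And>A. closedin T A \<Longrightarrow> A \<noteq> {} \<Longrightarrow> invariant A \<Longrightarrow> A \<subseteq> X \<Longrightarrow> A = X"
    using X by (auto simp: minimal_invariant_def)
  have XT: "X \<subseteq> topspace T"
    using closed closedin_subset by blast
  have actX: "act s x \<in> X" if "x \<in> X" for s x
    using inv that by (auto simp: invariant_def)
  let ?TX = "subtopology T X"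
  have topX: "topspace ?TX = X"
    using XT by auto
  have compactX: "compact_space ?TX"
    using closed compact closedin_compact_space compact_space_subtopology by blast
  have HausdorffX: "Hausdorff_space ?TX"
    using Hausdorff Hausdorff_space_subtopology by blast
  \<comment> \<open>The radius \<open>e / 4\<close> becomes \<open>e / 2\<close> after recentring at
    a point \<open>u\<close> of the open set, and \<open>e\<close> when two points are compared
    through the image of \<open>u\<close>.\<close>
  have "\<exists>q\<in>Q. ?TX interior_of {y \<in> X. d q y \<le> e / 4} \<noteq> {}"
  proof (rule ccontr)
    assume "\<not> ?thesis"
    moreover have "closedin ?TX {y \<in> X. d q y \<le> e / 4}" if "q \<in> Q" for q
    proof -
      have "closedin T (X \<inter> {y \<in> topspace T. d q y \<le> e / 4})"
        using Q(2) that closed by (intro closedin_Int closedin_cball) auto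
      also have "X \<inter> {y \<in> topspace T. d q y \<le> e / 4} = {y \<in> X. d q y \<le> e / 4}"
        using XT by auto
      finally show ?thesis
        using closedin_closed_subtopology[OF closed] by auto
    qed
    ultimately have "?TX interior_of \<Union>((\<lambda>q. {y \<in> X. d q y \<le> e / 4}) ` Q) = {}"
      using compactX HausdorffX Q(1)
      by (intro Baire_category_alt disjI2 conjI compact_imp_locally_compact_space
          compact_Hausdorff_imp_regular_space) auto
    also have "\<Union>((\<lambda>q. {y \<in> X. d q y \<le> e / 4}) ` Q) = topspace ?TX"
      using Q(3)[of _ "e / 4"] \<open>e > 0\<close> topX by (fastforce intro: less_imp_le)
    finally show False
      using \<open>X \<noteq> {}\<close> interior_of_topspace[of ?TX] unfolding topX by simp
  qed
  then obtain q where q: "q \<in> Q" and ne: "?TX interior_of {y \<in> X. d q y \<le> e / 4} \<noteq> {}"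
    by blast
  define U where "U = ?TX interior_of {y \<in> X. d q y \<le> e / 4}"
  have "U \<subseteq> {y \<in> X. d q y \<le> e / 4}"
    unfolding U_def by (rule interior_of_subset)
  then have U: "openin ?TX U" "U \<noteq> {}" "\<And>y. y \<in> U \<Longrightarrow> d q y \<le> e / 4"
    using ne by (auto simp: U_def)
  have UX: "U \<subseteq> X"
    using U(1) openin_subset topX by blast
  obtain u where u: "u \<in> U"
    using U(2) by blast
  have uT: "u \<in> topspace T"
    using u UX XT by blast
  have ball: "d u y \<le> e / 2" if "y \<in> U" for y
  proof -
    have "d u y \<le> d u q + d q y"
      using that UX XT u q Q(2) by (intro triangle) auto
    then show ?thesis
      using U(3)[OF that] U(3)[OF u] by (simp add: commute)
  qed
  \<comment> \<open>The orbit closure of \<open>x\<close> is closed and invariant, hence all of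
    \<open>X\<close> by minimality, so the orbit meets every nonempty relatively open set.\<close>
  have reach: "\<exists>s. act s x \<in> U" if x: "x \<in> X" for x
  proof -
    let ?O = "T closure_of (range (\<lambda>s. act s x))"
    have xT: "x \<in> topspace T"
      using x XT by blast
    have range: "range (\<lambda>s. act s x) \<subseteq> topspace T"
      using act_closed xT by blast
    have "?O = X"
    proof (rule minimal)
      show "invariant ?O"
        unfolding invariant_def
      proof (intro allI ballI)
        fix s y assume "y \<in> ?O"
        then have "act s y \<in> T closure_of (act s ` range (\<lambda>s. act s x))"
          using continuous_map_image_closure_subset[OF continuous_map_act] by blast
        moreover have "act s ` range (\<lambda>s. act s x) \<subseteq> range (\<lambda>s. act s x)"
          by (auto simp: act_mult[OF xT, symmetric])
        ultimately show "act s y \<in> ?O"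
          using closure_of_mono by blast
      qed
      show "?O \<noteq> {}"
        using closure_of_subset[OF range] by blast
      show "?O \<subseteq> X"
        using actX x closed by (intro closure_of_minimal) auto
    qed auto
    obtain W where W: "openin T W" "U = W \<inter> X"
      using U(1) by (auto simp: openin_subtopology)
    have "u \<in> ?O" "u \<in> W"
      using u W UX \<open>?O = X\<close> by auto
    then obtain s where "act s x \<in> W"
      using W(1) unfolding in_closure_of by blast
    then show ?thesis
      using W(2) actX[OF x] by blast
  qed
  let ?V = "\<lambda>s. {x \<in> X. act s x \<in> U}"
  have "openin ?TX (?V s)" for s
  proof -
    have "continuous_map ?TX ?TX (act s)"
      using continuous_map_act[of s] actX
      by (auto simp: continuous_map_in_subtopology continuous_map_from_subtopology topX)
    from openin_continuous_map_preimage[OF this U(1)] show ?thesis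
      by (simp only: topX)
  qed
  moreover have "X \<subseteq> \<Union>(range ?V)"
    using reach by blast
  ultimately obtain \<U> where \<U>: "finite \<U>" "\<U> \<subseteq> range ?V" "X \<subseteq> \<Union>\<U>"
    using compactX[unfolded compact_space_alt topX, rule_format, of "range ?V"] by blast
  then obtain S where S: "finite S" "\<U> = ?V ` S"
    using finite_subset_image[OF \<U>(1,2)] by blast
  obtain J where J: "closed_left_ideal J"
      "\<And>s y. s \<in> J \<Longrightarrow> y \<in> topspace T \<Longrightarrow> d (act s u) (act s y) \<le> d u y"
    using nonexpansive_ideal[OF uT] by blast
  \<comment> \<open>A point \<open>r\<close> of this intersection is, for every \<open>t\<close> in
    \<open>S\<close> at once, a limit of products \<open>s * t\<close> with \<open>s\<close> in
    \<open>J\<close>.\<close>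
  have "closed_left_ideal (\<Inter>((\<lambda>t. closure ((\<lambda>s. s * t) ` J)) ` S))"
    using S J(1) by (intro closed_left_ideal_Int_finite[OF reversible])
      (auto simp: closed_left_ideal_def left_ideal_mult_right intro!: closed_left_ideal_closure[unfolded closed_left_ideal_def])
  then obtain r where r: "r \<in> closure ((\<lambda>s. s * t) ` J)" if "t \<in> S" for t
    by (auto simp: closed_left_ideal_def left_ideal_def)
  have small: "d (act r y) (act r z) \<le> e" if t: "t \<in> S" and yz: "y \<in> ?V t" "z \<in> ?V t" for t y z
  proof -
    have yzT: "y \<in> topspace T" "z \<in> topspace T"
      using yz XT by auto
    have "d (act (s * t) y) (act (s * t) z) \<le> e" if "s \<in> J" for s
    proof -
      have T: "act t y \<in> topspace T" "act t z \<in> topspace T"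
        using yzT act_closed by auto
      have "d (act s (act t y)) (act s (act t z)) \<le> d (act s (act t y)) (act s u) + d (act s u) (act s (act t z))"
        using T uT act_closed by (intro triangle) auto
      also have "\<dots> \<le> d u (act t y) + d u (act t z)"
        using J(2)[OF that T(1)] J(2)[OF that T(2)] by (simp add: commute)
      also have "\<dots> \<le> e"
        using ball[of "act t y"] ball[of "act t z"] yz by simp
      finally show ?thesis
        using yzT by (simp add: act_mult)
    qed
    then have "closure ((\<lambda>s. s * t) ` J) \<subseteq> {r. d (act r y) (act r z) \<le> e}"
      using yzT by (intro closure_minimal closed_dist_le) auto
    then show ?thesis
      using r[OF t] by blast
  qed
  define pick where "pick t = (SOME y. y \<in> ?V t)" for t
  have pick: "pick t \<in> ?V t" if "y \<in> ?V t" for t y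
    unfolding pick_def using that by (rule someI)
  show ?thesis
  proof (intro exI[of _ "(\<lambda>t. act r (pick t)) ` {t \<in> S. ?V t \<noteq> {}}"] conjI ballI)
    show "finite ((\<lambda>t. act r (pick t)) ` {t \<in> S. ?V t \<noteq> {}})"
      using S by simp
    show "(\<lambda>t. act r (pick t)) ` {t \<in> S. ?V t \<noteq> {}} \<subseteq> X"
      using pick actX by blast
    fix x assume "x \<in> X"
    then obtain x' where x': "x' \<in> X" "x = act r x'"
      using image[of r] by blast
    then obtain t where t: "t \<in> S" "x' \<in> ?V t"
      using \<U>(3) S(2) by blast
    then show "\<exists>y\<in>(\<lambda>t. act r (pick t)) ` {t \<in> S. ?V t \<noteq> {}}. d y x \<le> e"
      using small[OF t(1) pick[OF t(2)] t(2)] x'(2) by blast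
  qed
qed

end

subsection \<open>Good metrics and convexity\<close>

context
  fixes d :: "'x::real_vector \<Rightarrow> 'x \<Rightarrow> real"
  assumes metric: "Metric_space UNIV d" and good: "good_metric d"
begin

lemma good_metric_diff: "d x y = d (x - y) 0"
proof -
  have "d (y + (x - y)) (y + 0) = d (x - y) 0"
    using good unfolding good_metric_def by blast
  then show ?thesis
    by simp
qed

lemma good_metric_add_le: "d (x + y) 0 \<le> d x 0 + d y 0"
  using Metric_space.triangle[OF metric, of "x + y" y 0] good_metric_diff[of "x + y" y] by simp

lemma good_metric_absolutely_convex:
  assumes "d x 0 < r" "d y 0 < r" "\<bar>a\<bar> + \<bar>b\<bar> \<le> 1"
  shows "d (a *\<^sub>R x + b *\<^sub>R y) 0 < r"
proof -
  have "0 < r"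
    using assms(1) Metric_space.nonneg[OF metric, of x 0] by linarith
  then have "absolutely_convex {x. d x 0 < r}"
    using good unfolding good_metric_def by blast
  then show ?thesis
    using assms unfolding absolutely_convex_def by blast
qed

text \<open>Absolute convexity is given for open balls; the weak inequality follows by letting the
  radius decrease to \<open>d x 0\<close>.\<close>

lemma good_metric_scaleR_le:
  assumes "\<bar>a\<bar> \<le> 1"
  shows "d (a *\<^sub>R x) 0 \<le> d x 0"
proof (rule dense_ge)
  fix r assume "d x 0 < r"
  then show "d (a *\<^sub>R x) 0 \<le> r"
    using good_metric_absolutely_convex[of x r x a 0] assms by simp
qed

lemma convex_good_metric_cball: "convex {x. d x 0 \<le> c}"
  unfolding convex_def mem_Collect_eq
proof (intro allI ballI impI dense_ge[of c])
  fix x y :: 'x and a b c' :: real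
  assume "x \<in> {x. d x 0 \<le> c}" "y \<in> {x. d x 0 \<le> c}" "0 \<le> a" "0 \<le> b" "a + b = 1" "c < c'"
  then show "d (a *\<^sub>R x + b *\<^sub>R y) 0 \<le> c'"
    using good_metric_absolutely_convex[of x c' y a b] by simp
qed

lemma good_metric_sum_le:
  assumes "finite F" "sum a F = 1" "\<And>i. i \<in> F \<Longrightarrow> 0 \<le> a i" "\<And>i. i \<in> F \<Longrightarrow> d (v i) 0 \<le> c"
  shows "d (\<Sum>i\<in>F. a i *\<^sub>R v i) 0 \<le> c"
  using convex_sum[OF assms(1) convex_good_metric_cball[of c] assms(2,3), of v] assms(4) by simp

lemma good_metric_multiple_le: "d (real k *\<^sub>R x) 0 \<le> real k * d x 0"
proof (induction k)
  case 0
  then show ?case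
    using Metric_space.mdist_zero[OF metric] by simp
next
  case (Suc k)
  then show ?case
    using good_metric_add_le[of x "real k *\<^sub>R x"] by (simp add: algebra_simps)
qed

lemma good_metric_divide_antimono:
  assumes "0 < k" "k \<le> l"
  shows "d ((1 / real l) *\<^sub>R x) 0 \<le> d ((1 / real k) *\<^sub>R x) 0"
  using good_metric_scaleR_le[of "real k / real l" "(1 / real k) *\<^sub>R x"] assms by simp

text \<open>Scalar multiplication is continuous at the scalar 0 for the
  \<open>d\<close>-topology.\<close>

lemma good_metric_divide_small:
  assumes "locally_convex_topology (metric_topology d)" "e > 0"
  shows "\<exists>k>0. d ((1 / real k) *\<^sub>R x) 0 < e"
proof -
  interpret Metric_space UNIV d
    by (rule metric)
  have cont: "continuous_map (prod_topology euclideanreal mtopology) mtopology (\<lambda>(c, x). c *\<^sub>R x)"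
    using assms(1) by (simp add: locally_convex_topology_def)
  have "continuous_map euclideanreal (prod_topology euclideanreal mtopology) (\<lambda>c. (c, x))"
    by (intro continuous_map_pairedI) auto
  from continuous_map_compose[OF this cont] have "continuous_map euclideanreal mtopology (\<lambda>c. c *\<^sub>R x)"
    by (simp add: o_def)
  from openin_continuous_map_preimage[OF this openin_mball[of 0 e]]
  have "open {c. d 0 (c *\<^sub>R x) < e}"
    by simp
  moreover have "0 \<in> {c. d 0 (c *\<^sub>R x) < e}"
    using assms(2) by simp
  ultimately obtain r where r: "r > 0" "ball 0 r \<subseteq> {c. d 0 (c *\<^sub>R x) < e}"
    using open_contains_ball by blast
  obtain n where n: "inverse (real (Suc n)) < r"
    using reals_Archimedean r(1) by blast
  then have "1 / real (Suc n) \<in> ball 0 r"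
    by (simp add: inverse_eq_divide)
  then have "d 0 ((1 / real (Suc n)) *\<^sub>R x) < e"
    using r(2) by blast
  then show ?thesis
    by (metis commute zero_less_Suc)
qed

end

section \<open>Counting steps between points of a convex set\<close>

text \<open>Differences and their multiples leave \<open>topspace T\<close>, so \<open>d\<close> is
  assumed to be a metric on the whole vector space, besides the inherited assumption on
  \<open>topspace T\<close>.\<close>

locale convex_nonexpansive_action = nonexpansive_action T act d
  for T :: "'x::real_vector topology" and act :: "'s::semitopological_semigroup \<Rightarrow> 'x \<Rightarrow> 'x"
    and d :: "'x \<Rightarrow> 'x \<Rightarrow> real" +
  assumes convex: "convex (topspace T)"
    and metric: "Metric_space UNIV d" and good: "good_metric d"
    and divide_small: "e > 0 \<Longrightarrow> \<exists>k>0. d ((1 / real k) *\<^sub>R v) 0 < e"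
    and closedin_scaled_cball: "closedin T {w \<in> topspace T. d (a *\<^sub>R (x - w)) 0 \<le> c}"
begin

lemmas diff = good_metric_diff[OF metric good]
lemmas add_le = good_metric_add_le[OF metric good]
lemmas scaleR_le = good_metric_scaleR_le[OF metric good]
lemmas sum_le = good_metric_sum_le[OF metric good]
lemmas convex_cball = convex_good_metric_cball[OF metric good]

text \<open>The relation says that \<open>x - z\<close> lies in \<open>B\<^sub>r + k B\<^sub>c\<close>, with the intermediate point of the
  decomposition inside the convex set. A good metric need not be homogeneous, so a ball
  may be much larger than the union of the smaller concentric balls; letting \<open>k\<close> vary
  for a small \<open>c\<close> makes up for the missing continuity in the radius.\<close>

definition near :: "real \<Rightarrow> nat \<Rightarrow> real \<Rightarrow> 'x \<Rightarrow> 'x \<Rightarrow> bool"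
  where "near r k c z x \<longleftrightarrow>
    (\<exists>w\<in>topspace T. d z w \<le> r \<and> d ((1 / real k) *\<^sub>R (x - w)) 0 \<le> c)"

text \<open>The intermediate point ranges over a compact space, and projecting along a compact
  factor is a closed map.\<close>

lemma closedin_near: "closedin T {z \<in> topspace T. near r k c z x}"
proof -
  let ?A = "{z \<in> topspace T \<times> topspace T. d (fst z) (snd z) \<le> r}"
  let ?W = "{w \<in> topspace T. d ((1 / real k) *\<^sub>R (x - w)) 0 \<le> c}"
  let ?B = "{z \<in> topspace (prod_topology T T). snd z \<in> ?W}"
  have "closedin (prod_topology T T) (?A \<inter> ?B)"
    by (intro closedin_Int closedin_dist_le closedin_continuous_map_preimage[OF continuous_map_snd]
        closedin_scaled_cball)
  then have "closedin T (fst ` (?A \<inter> ?B))"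
    using closed_map_fst[OF compact] unfolding closed_map_def by blast
  also have "fst ` (?A \<inter> ?B) = {z \<in> topspace T. near r k c z x}"
    unfolding near_def by (force simp: image_iff)
  finally show ?thesis .
qed

text \<open>The same convex combination of the two intermediate points serves as the new one, since
  balls are convex.\<close>

lemma convex_near: "convex {z \<in> topspace T. near r k c z x}"
  unfolding convex_def
proof (intro ballI allI impI)
  fix z1 z2 and a b :: real
  assume z1: "z1 \<in> {z \<in> topspace T. near r k c z x}" and z2: "z2 \<in> {z \<in> topspace T. near r k c z x}"
    and ab: "0 \<le> a" "0 \<le> b" "a + b = 1"
  obtain w1 where w1: "w1 \<in> topspace T" "d z1 w1 \<le> r" "d ((1 / real k) *\<^sub>R (x - w1)) 0 \<le> c"
    using z1 by (auto simp: near_def)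
  obtain w2 where w2: "w2 \<in> topspace T" "d z2 w2 \<le> r" "d ((1 / real k) *\<^sub>R (x - w2)) 0 \<le> c"
    using z2 by (auto simp: near_def)
  let ?w = "a *\<^sub>R w1 + b *\<^sub>R w2"
  have "(a *\<^sub>R z1 + b *\<^sub>R z2) - ?w = a *\<^sub>R (z1 - w1) + b *\<^sub>R (z2 - w2)"
    by (simp add: algebra_simps)
  then have "d (a *\<^sub>R z1 + b *\<^sub>R z2) ?w \<le> r"
    using convexD[OF convex_cball[of r], of "z1 - w1" "z2 - w2" a b] w1(2) w2(2) ab
    by (simp add: diff[of _ ?w] diff[of z1 w1] diff[of z2 w2])
  moreover have "(a + b) *\<^sub>R x - ?w = a *\<^sub>R (x - w1) + b *\<^sub>R (x - w2)"
    by (simp add: algebra_simps)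
  then have "x - ?w = a *\<^sub>R (x - w1) + b *\<^sub>R (x - w2)"
    using ab by simp
  then have "(1 / real k) *\<^sub>R (x - ?w) = a *\<^sub>R ((1 / real k) *\<^sub>R (x - w1)) + b *\<^sub>R ((1 / real k) *\<^sub>R (x - w2))"
    by (simp only: scaleR_add_right scaleR_left_commute)
  then have "d ((1 / real k) *\<^sub>R (x - ?w)) 0 \<le> c"
    using convexD[OF convex_cball[of c], of "(1 / real k) *\<^sub>R (x - w1)" "(1 / real k) *\<^sub>R (x - w2)" a b] w1(3) w2(3) ab
    by simp
  moreover have "?w \<in> topspace T" "a *\<^sub>R z1 + b *\<^sub>R z2 \<in> topspace T"
    using convexD[OF convex] w1 w2 z1 z2 ab by auto
  ultimately show "a *\<^sub>R z1 + b *\<^sub>R z2 \<in> {z \<in> topspace T. near r k c z x}"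
    unfolding near_def by blast
qed

lemma near_mono: "near r k c z x \<Longrightarrow> c \<le> c' \<Longrightarrow> near r k c' z x"
  unfolding near_def by (meson order_trans)

text \<open>The segment from the intermediate point \<open>w\<close> to \<open>x\<close> is cut into \<open>k\<close> pieces, each of which is not
  stretched by the action.\<close>

lemma near_act:
  assumes near: "near r k c z x" and zx: "z \<in> topspace T" "x \<in> topspace T" and "0 < k"
  obtains J where "closed_left_ideal J" "\<And>s. s \<in> J \<Longrightarrow> near r k c (act s z) (act s x)"
proof -
  obtain w where w: "w \<in> topspace T" "d z w \<le> r" "d ((1 / real k) *\<^sub>R (x - w)) 0 \<le> c"
    using near by (auto simp: near_def)
  define p where "p j = w + (real j / real k) *\<^sub>R (x - w)" for j
  have p_eq: "p j = (1 - real j / real k) *\<^sub>R w + (real j / real k) *\<^sub>R x" for j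
    by (simp add: p_def algebra_simps)
  have p_in: "p j \<in> topspace T" if "j \<le> k" for j
    unfolding p_eq using that \<open>0 < k\<close> w(1) zx by (intro convexD[OF convex]) auto
  have p0: "p 0 = w" and pk: "p k = x"
    using \<open>0 < k\<close> by (simp_all add: p_def)
  have step: "d (p (Suc j)) (p j) \<le> c" for j
  proof -
    have "p (Suc j) - p j = (1 / real k) *\<^sub>R (x - w)"
      by (simp add: p_def add_divide_distrib scaleR_left_distrib)
    then show ?thesis
      using w(3) by (simp add: diff[of "p (Suc j)"])
  qed
  obtain J where J: "closed_left_ideal J"
      "\<And>s u y. s \<in> J \<Longrightarrow> u \<in> insert z (p ` {..k}) \<Longrightarrow> y \<in> topspace T \<Longrightarrow> d (act s u) (act s y) \<le> d u y"
    using nonexpansive_ideal_finite[of "insert z (p ` {..k})"] p_in zx by blast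
  show ?thesis
  proof (rule that[OF J(1)])
    fix s assume s: "s \<in> J"
    have "d (act s z) (act s w) \<le> r"
      using J(2)[OF s _ w(1), of z] w(2) by simp
    moreover have "d ((1 / real k) *\<^sub>R (act s x - act s w)) 0 \<le> c"
    proof -
      have "d (act s (p (Suc j)) - act s (p j)) 0 \<le> c" if "j \<in> {..<k}" for j
        using J(2)[OF s _ p_in, of "p (Suc j)" j] step[of j] that by (simp add: diff[of "act s _"])
      \<comment> \<open>The average of the \<open>k\<close> image pieces telescopes to the scaled
        difference of the endpoints, and the ball of radius \<open>c\<close> is convex.\<close>
      then have "d (\<Sum>j<k. (1 / real k) *\<^sub>R (act s (p (Suc j)) - act s (p j))) 0 \<le> c"
        using \<open>0 < k\<close> by (intro sum_le) auto
      also have "(\<Sum>j<k. (1 / real k) *\<^sub>R (act s (p (Suc j)) - act s (p j))) = (1 / real k) *\<^sub>R (act s x - act s w)"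
        unfolding scaleR_sum_right[symmetric] by (simp add: sum_lessThan_telescope[of "\<lambda>j. act s (p j)"] p0 pk)
      finally show ?thesis .
    qed
    ultimately show "near r k c (act s z) (act s x)"
      using act_closed[OF w(1)] unfolding near_def by blast
  qed
qed

lemma limit_set_near:
  assumes X: "X \<subseteq> topspace T" and image: "\<And>s. act s ` X = X"
    and bounded: "\<And>e. e > 0 \<Longrightarrow> \<exists>F. finite F \<and> F \<subseteq> X \<and> (\<forall>x\<in>X. \<exists>y\<in>F. d y x \<le> e)"
    and z: "z \<in> topspace T" and near: "\<And>x. x \<in> X \<Longrightarrow> near r k c z x" and "0 < k" "0 < \<eta>" and x: "x \<in> X"
  shows "limit_set z \<subseteq> {z \<in> topspace T. near r k (c + \<eta>) z x}"
proof -
  obtain F where F: "finite F" "F \<subseteq> X" "\<forall>x\<in>X. \<exists>y\<in>F. d y x \<le> \<eta>"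
    using bounded[OF \<open>0 < \<eta>\<close>] by blast
  have "\<exists>J. closed_left_ideal J \<and> (\<forall>s\<in>J. near r k c (act s z) (act s y))" if "y \<in> F" for y
  proof -
    have "near r k c z y" "y \<in> topspace T"
      using that F X near by auto
    then show ?thesis
      using near_act[of r k c z y] z \<open>0 < k\<close> by metis
  qed
  then obtain I where I: "closed_left_ideal (I y)" "\<forall>s\<in>I y. near r k c (act s z) (act s y)" if "y \<in> F" for y
    by metis
  obtain J where J: "closed_left_ideal J"
      "\<And>s u y. s \<in> J \<Longrightarrow> u \<in> F \<Longrightarrow> y \<in> topspace T \<Longrightarrow> d (act s u) (act s y) \<le> d u y"
    using nonexpansive_ideal_finite[of F] F X by blast
  let ?J = "\<Inter>(insert J (I ` F))"
  have "closed_left_ideal ?J"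
    using J I F by (intro closed_left_ideal_Int_finite[OF reversible]) auto
  then have "limit_set z \<subseteq> T closure_of ((\<lambda>s. act s z) ` ?J)"
    unfolding limit_set_def by blast
  also have "\<dots> \<subseteq> {z \<in> topspace T. near r k (c + \<eta>) z x}"
  proof (rule closure_of_minimal[OF _ closedin_near], clarify)
    fix s assume s: "s \<in> ?J"
    obtain x' where x': "x' \<in> X" "x = act s x'"
      using image[of s] x by blast
    obtain y where y: "y \<in> F" "d y x' \<le> \<eta>"
      using F(3) x' by blast
    have "near r k c (act s z) (act s y)"
      using I(2)[OF y(1)] s y(1) by blast
    then obtain w where w: "w \<in> topspace T" "d (act s z) w \<le> r" "d ((1 / real k) *\<^sub>R (act s y - w)) 0 \<le> c"
      unfolding near_def by blast
    have "d (act s y) x \<le> \<eta>"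
      using J(2)[of s y x'] s y x' X by fastforce
    then have "d (x - act s y) 0 \<le> \<eta>"
      using diff[of x "act s y"] commute[of x "act s y"] by simp
    then have "d ((1 / real k) *\<^sub>R (x - act s y)) 0 \<le> \<eta>"
      using scaleR_le[of "1 / real k" "x - act s y"] \<open>0 < k\<close> by simp
    moreover have "(1 / real k) *\<^sub>R (x - w) = (1 / real k) *\<^sub>R (act s y - w) + (1 / real k) *\<^sub>R (x - act s y)"
      by (simp add: algebra_simps)
    ultimately have "d ((1 / real k) *\<^sub>R (x - w)) 0 \<le> c + \<eta>"
      using add_le[of "(1 / real k) *\<^sub>R (act s y - w)" "(1 / real k) *\<^sub>R (x - act s y)"] w(3) by simp
    then show "act s z \<in> topspace T \<and> near r k (c + \<eta>) (act s z) x"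
      using w act_closed[OF z] unfolding near_def by blast
  qed
  finally show ?thesis .
qed

section \<open>Stable sets and normal structure\<close>

text \<open>Limit sets replace invariance under the action because the estimates for
  \<open>near\<close> are available only along closed left ideals.\<close>

definition stable :: "'x set \<Rightarrow> bool"
  where "stable C \<longleftrightarrow> closedin T C \<and> C \<noteq> {} \<and> convex C \<and> (\<forall>z\<in>C. limit_set z \<subseteq> C)"

lemma minimal_stable_exists:
  assumes "topspace T \<noteq> {}"
  obtains C where "stable C" "\<And>A. stable A \<Longrightarrow> A \<subseteq> C \<Longrightarrow> A = C"
proof -
  obtain C where "C \<in> Collect stable" "\<And>A. A \<in> Collect stable \<Longrightarrow> A \<subseteq> C \<Longrightarrow> A = C"
  proof (rule minimal_closed_set[OF compact, of "topspace T" "Collect stable"])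
    show "topspace T \<in> Collect stable"
      using assms convex closedin_limit_set closedin_subset unfolding stable_def by blast
    fix \<C> assume C: "\<C> \<noteq> {}" "\<C> \<subseteq> Collect stable" "\<Inter>\<C> \<noteq> {}"
    have "closedin T (\<Inter>\<C>)" "convex (\<Inter>\<C>)"
      using C by (auto intro!: closedin_Inter convex_Inter simp: stable_def)
    moreover have "limit_set z \<subseteq> \<Inter>\<C>" if "z \<in> \<Inter>\<C>" for z
      using that C(2) unfolding stable_def by blast
    ultimately show "\<Inter>\<C> \<in> Collect stable"
      using C(3) by (simp add: stable_def)
  qed (auto simp: stable_def)
  then show ?thesis
    using that by simp
qed

text \<open>The analogue of De Marr's normal structure argument: for the least \<open>k\<close> for which any two points
  of \<open>X\<close> are \<open>near\<close>, the barycentre of a finite \<open>r\<close>-net of \<open>X\<close> achieves \<open>k - 1\<close>, provided that \<open>k\<close>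
  exceeds the cardinality of the net.\<close>

lemma barycentre_near:
  assumes F: "finite F" "F \<noteq> {}" "F \<subseteq> topspace T" and n: "card F \<le> j"
    and x: "x \<in> topspace T" and y: "y \<in> F" "d y x \<le> r"
    and near: "\<And>z. z \<in> F \<Longrightarrow> near r (Suc j) c z x"
  shows "near r j c (\<Sum>z\<in>F. (1 / real (card F)) *\<^sub>R z) x"
proof -
  define n where "n = card F"
  have n0: "0 < n"
    using F by (simp add: n_def card_gt_0_iff)
  have "0 < j"
    using n0 n n_def by linarith
  have c: "0 \<le> c"
    using near[OF y(1)] Metric_space.nonneg[OF metric] unfolding near_def by (meson order_trans)
  have "\<exists>w\<in>topspace T. d z w \<le> r \<and> d ((1 / real (Suc j)) *\<^sub>R (x - w)) 0 \<le> c" if "z \<in> F" for z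
    using near[OF that] unfolding near_def .
  then obtain w0 where w0: "w0 z \<in> topspace T" "d z (w0 z) \<le> r" "d ((1 / real (Suc j)) *\<^sub>R (x - w0 z)) 0 \<le> c"
    if "z \<in> F" for z
    by metis
  \<comment> \<open>For the net point \<open>y\<close> within \<open>r\<close> of \<open>x\<close>,
    the point \<open>x\<close> itself is a valid intermediate point. Its difference vector is 0,
    which is where the step is saved.\<close>
  define w where "w = w0(y := x)"
  have w: "w z \<in> topspace T" "d z (w z) \<le> r" if "z \<in> F" for z
    using w0[OF that] x y(2) by (auto simp: w_def)
  define v where "v z = (1 / real (Suc j)) *\<^sub>R (x - w z)" for z
  have vy: "v y = 0"
    by (simp add: v_def w_def)
  have v: "d (v z) 0 \<le> c" if "z \<in> F" for z
    using w0(3)[OF that] c Metric_space.mdist_zero[OF metric] by (auto simp: v_def w_def)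
  let ?u = "\<Sum>z\<in>F. (1 / real n) *\<^sub>R z" and ?w = "\<Sum>z\<in>F. (1 / real n) *\<^sub>R w z"
  have weights: "(\<Sum>z\<in>F. 1 / real n) = 1"
    using n0 by (simp add: n_def)
  have "?u - ?w = (\<Sum>z\<in>F. (1 / real n) *\<^sub>R (z - w z))"
    by (simp add: sum_subtractf scaleR_diff_right)
  moreover have "d (z - w z) 0 \<le> r" if "z \<in> F" for z
    using w(2)[OF that] by (simp add: diff[of z])
  then have "d (\<Sum>z\<in>F. (1 / real n) *\<^sub>R (z - w z)) 0 \<le> r"
    by (intro sum_le F(1) weights) auto
  ultimately have "d ?u ?w \<le> r"
    by (simp add: diff[of ?u])
  moreover have "?w \<in> topspace T"
    using w(1) by (intro convex_sum F(1) convex weights) auto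
  moreover have "d ((1 / real j) *\<^sub>R (x - ?w)) 0 \<le> c"
  proof -
    \<comment> \<open>The factor \<open>t\<close> rescales from \<open>Suc j\<close> to
      \<open>j\<close> steps and includes the weight \<open>1 / n\<close>. The \<open>n - 1\<close>
      points other than \<open>y\<close> have total weight \<open>(n - 1) * t\<close>, at most 1
      because \<open>n \<le> j\<close>; the rest is put on \<open>v y = 0\<close>.\<close>
    define t where "t = real (Suc j) / (real n * real j)"
    define a where "a z = (if z = y then 1 - (real n - 1) * t else t)" for z
    have "real (n - 1) * real (Suc j) \<le> real n * real j"
    proof -
      have "(n - 1) * Suc j \<le> n * j"
        using n n0 by (cases n) (auto simp: n_def)
      then show ?thesis
        by (metis of_nat_le_iff of_nat_mult)
    qed
    then have "(real n - 1) * t \<le> 1"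
      using n0 \<open>0 < j\<close> by (simp add: t_def field_simps of_nat_diff)
    moreover have "0 \<le> t"
      by (simp add: t_def)
    ultimately have a: "0 \<le> a z" for z
      by (simp add: a_def)
    have "sum a F = a y + sum a (F - {y})"
      using F(1) y(1) by (simp add: sum.remove)
    also have "sum a (F - {y}) = (\<Sum>z\<in>F - {y}. t)"
      by (intro sum.cong) (auto simp: a_def)
    also have "\<dots> = (real n - 1) * t"
      using F(1) y(1) n0 by (simp add: n_def of_nat_diff Suc_leI)
    finally have "sum a F = 1"
      by (simp add: a_def)
    then have "d (\<Sum>z\<in>F. a z *\<^sub>R v z) 0 \<le> c"
      using v a by (intro sum_le F(1)) auto
    also have "(\<Sum>z\<in>F. a z *\<^sub>R v z) = (\<Sum>z\<in>F. (1 / real j) *\<^sub>R ((1 / real n) *\<^sub>R (x - w z)))"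
    proof (intro sum.cong refl)
      fix z
      have "t *\<^sub>R v z = (1 / real j) *\<^sub>R ((1 / real n) *\<^sub>R (x - w z))"
        unfolding v_def scaleR_scaleR by (simp add: t_def)
      then show "a z *\<^sub>R v z = (1 / real j) *\<^sub>R ((1 / real n) *\<^sub>R (x - w z))"
        using vy by (cases "z = y") (simp_all add: a_def w_def)
    qed
    also have "\<dots> = (1 / real j) *\<^sub>R (\<Sum>z\<in>F. (1 / real n) *\<^sub>R (x - w z))"
      by (simp only: scaleR_sum_right)
    also have "(\<Sum>z\<in>F. (1 / real n) *\<^sub>R (x - w z)) = (\<Sum>z\<in>F. 1 / real n) *\<^sub>R x - ?w"
      by (simp only: scaleR_diff_right sum_subtractf scaleR_sum_left)
    also have "\<dots> = x - ?w"
      by (simp only: weights scaleR_one)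
    finally show ?thesis .
  qed
  ultimately show ?thesis
    unfolding near_def n_def by blast
qed

text \<open>Bounds the number of steps from below: points far apart cannot be joined by few small
  steps.\<close>

lemma near_far:
  assumes "near r k c z x"  "0 < k"
  shows "d z x \<le> r + real k * c"
proof -
  obtain w where w: "d z w \<le> r" "d ((1 / real k) *\<^sub>R (x - w)) 0 \<le> c"
    using assms by (auto simp: near_def)
  have "d w x = d (real k *\<^sub>R ((1 / real k) *\<^sub>R (x - w))) 0"
    using assms(2) diff[of x w] commute[of w x] by simp
  also have "\<dots> \<le> real k * d ((1 / real k) *\<^sub>R (x - w)) 0"
    by (rule good_metric_multiple_le[OF metric good])
  also have "\<dots> \<le> real k * c"
    using w(2) by (intro mult_left_mono) auto
  finally show ?thesis
    using Metric_space.triangle[OF metric, of z w x] w(1) by simp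
qed

text \<open>Total boundedness reduces the differences of points of \<open>X\<close>, up to errors
  \<open>c / 3\<close>, to finitely many vectors, each of which becomes small after division by a
  large integer. The intermediate point is \<open>z\<close> itself.\<close>

lemma near_large:
  assumes X: "X \<subseteq> topspace T"
    and bounded: "\<And>e. e > 0 \<Longrightarrow> \<exists>F. finite F \<and> F \<subseteq> X \<and> (\<forall>x\<in>X. \<exists>y\<in>F. d y x \<le> e)"
    and "0 < c" "0 \<le> r"
  obtains k where "0 < k" "\<And>z x. z \<in> X \<Longrightarrow> x \<in> X \<Longrightarrow> near r k c z x"
proof -
  obtain F where F: "finite F" "F \<subseteq> X" "\<forall>x\<in>X. \<exists>y\<in>F. d y x \<le> c / 3"
    using bounded[of "c / 3"] \<open>0 < c\<close> by auto
  obtain K where K: "0 < K v" "d ((1 / real (K v)) *\<^sub>R v) 0 < c / 3" for v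
    using divide_small[of "c / 3"] \<open>0 < c\<close> by (metis divide_pos_pos zero_less_numeral)
  \<comment> \<open>The sum dominates every \<open>K (g - f)\<close>, and \<open>Suc\<close> keeps
    \<open>k\<close> positive even for an empty net.\<close>
  define k where "k = Suc (\<Sum>(f, g)\<in>F \<times> F. K (g - f))"
  have Kk: "K (g - f) \<le> k" if "f \<in> F" "g \<in> F" for f g
  proof -
    have "K (g - f) \<le> (\<Sum>(f, g)\<in>F \<times> F. K (g - f))"
      using member_le_sum[of "(f, g)" "F \<times> F" "\<lambda>(f, g). K (g - f)"] that F(1) by auto
    then show ?thesis
      by (simp add: k_def)
  qed
  show ?thesis
  proof (rule that)
    show "0 < k"
      by (simp add: k_def)
    then have small: "\<bar>1 / real k\<bar> \<le> 1"
      by simp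
    fix z x assume zx: "z \<in> X" "x \<in> X"
    obtain f g where fg: "f \<in> F" "d f z \<le> c / 3" "g \<in> F" "d g x \<le> c / 3"
      using F(3) zx by blast
    have "d ((1 / real k) *\<^sub>R (f - z)) 0 \<le> c / 3"
      using scaleR_le[OF small, of "f - z"] fg(2) by (simp add: diff[of f z])
    moreover have "d ((1 / real k) *\<^sub>R (x - g)) 0 \<le> c / 3"
      using scaleR_le[OF small, of "x - g"] fg(4) by (simp add: diff[of x g, symmetric] commute[of x g])
    moreover have "d ((1 / real k) *\<^sub>R (g - f)) 0 \<le> c / 3"
      using good_metric_divide_antimono[OF metric good K(1) Kk[OF fg(1,3)], of "g - f"] K(2)[of "g - f"] by simp
    moreover have "(1 / real k) *\<^sub>R (x - z) =
        (1 / real k) *\<^sub>R (x - g) + ((1 / real k) *\<^sub>R (g - f) + (1 / real k) *\<^sub>R (f - z))"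
      by (simp add: algebra_simps)
    ultimately have "d ((1 / real k) *\<^sub>R (x - z)) 0 \<le> c"
      using add_le[of "(1 / real k) *\<^sub>R (x - g)" "(1 / real k) *\<^sub>R (g - f) + (1 / real k) *\<^sub>R (f - z)"]
        add_le[of "(1 / real k) *\<^sub>R (g - f)" "(1 / real k) *\<^sub>R (f - z)"] by simp
    then show "near r k c z x"
      using zx X \<open>0 \<le> r\<close> Metric_space.mdist_zero[OF metric] unfolding near_def by (intro bexI[of _ z]) auto
  qed
qed

text \<open>The least step count plays the role of the diameter of \<open>X\<close>. If
  \<open>X\<close> had two points, the points of \<open>C\<close> that reach all of \<open>X\<close>
  in one step fewer would form a stable set, nonempty by \<open>barycentre_near\<close>.\<close>

lemma minimal_invariant_singleton:
  assumes X: "X \<noteq> {}" "X \<subseteq> C" and image: "\<And>s. act s ` X = X"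
    and bounded: "\<And>e. e > 0 \<Longrightarrow> \<exists>F. finite F \<and> F \<subseteq> X \<and> (\<forall>x\<in>X. \<exists>y\<in>F. d y x \<le> e)"
    and C: "stable C" and minimal: "\<And>A. stable A \<Longrightarrow> A \<subseteq> C \<Longrightarrow> A = C"
    and ab: "a \<in> X" "b \<in> X"
  shows "a = b"
proof (rule ccontr)
  assume "a \<noteq> b"
  have CT: "C \<subseteq> topspace T"
    using C closedin_subset by (auto simp: stable_def)
  have XT: "X \<subseteq> topspace T"
    using X CT by blast
  define r where "r = d a b / 2"
  have r: "0 < r"
    using \<open>a \<noteq> b\<close> Metric_space.mdist_pos_less[OF metric] by (simp add: r_def)
  obtain F where F: "finite F" "F \<subseteq> X" "\<forall>x\<in>X. \<exists>y\<in>F. d y x \<le> r"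
    using bounded[OF r] by blast
  have "F \<noteq> {}"
    using F(3) X(1) by blast
  define n where "n = card F"
  have n: "0 < n"
    using F(1) \<open>F \<noteq> {}\<close> by (simp add: n_def card_gt_0_iff)
  \<comment> \<open>With this choice \<open>n\<close> steps of size \<open>2 * c\<close> add up to
    \<open>r / 2\<close>, so \<open>k \<le> n\<close> would give
    \<open>d a b \<le> r + r / 2\<close>, although \<open>d a b = 2 * r\<close>.\<close>
  define c where "c = r / (4 * real n)"
  have c: "0 < c"
    using r n by (simp add: c_def)
  define P where "P k \<longleftrightarrow> 0 < k \<and> (\<forall>z\<in>X. \<forall>x\<in>X. \<forall>\<eta>>0. near r k (c + \<eta>) z x)" for k
  have "\<exists>k. P k"
    using near_large[OF XT bounded c] r unfolding P_def by (metis less_imp_le near_mono less_add_same_cancel1)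
  define k where "k = (LEAST k. P k)"
  have Pk: "P k"
    unfolding k_def by (rule LeastI_ex) fact
  have least: "\<not> P j" if "j < k" for j
    using that not_less_Least unfolding k_def by blast
  have "n < k"
  proof (rule ccontr)
    assume "\<not> n < k"
    have "near r k (c + c) a b"
      using Pk c ab unfolding P_def by blast
    then have "d a b \<le> r + real k * (c + c)"
      using Pk by (intro near_far) (auto simp: P_def)
    also have "real k * (c + c) \<le> real n * (c + c)"
      using \<open>\<not> n < k\<close> c by (intro mult_right_mono) auto
    also have "real n * (c + c) = r / 2"
      using n by (simp add: c_def)
    finally show False
      using r by (simp add: r_def)
  qed
  then obtain j where j: "k = Suc j" "n \<le> j"
    by (metis less_Suc_eq_le not0_implies_Suc not_less_zero)
  let ?A = "C \<inter> (\<Inter>x\<in>X. \<Inter>\<eta>\<in>{0<..}. {z \<in> topspace T. near r j (c + \<eta>) z x})"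
  have "stable ?A"
    unfolding stable_def
  proof (intro conjI ballI)
    show "closedin T ?A"
      using C X(1) gt_ex[of "0 :: real"] by (intro closedin_Int closedin_INT closedin_near) (auto simp: stable_def)
    show "convex ?A"
      using C by (intro convex_Int convex_INT convex_near) (auto simp: stable_def)
    have "(\<Sum>z\<in>F. (1 / real n) *\<^sub>R z) \<in> C"
      using C F X n by (intro convex_sum) (auto simp: stable_def n_def)
    moreover have "near r j (c + \<eta>) (\<Sum>z\<in>F. (1 / real n) *\<^sub>R z) x" if x: "x \<in> X" and "0 < \<eta>" for x \<eta>
    proof -
      obtain y where y: "y \<in> F" "d y x \<le> r"
        using F(3) x by blast
      have "near r (Suc j) (c + \<eta>) z x" if "z \<in> F" for z
        using Pk that x \<open>0 < \<eta>\<close> F(2) unfolding P_def j by blast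
      then show ?thesis
        unfolding n_def using F XT x j(2) \<open>F \<noteq> {}\<close> y by (intro barycentre_near) (auto simp: n_def)
    qed
    ultimately show "?A \<noteq> {}"
      using CT by blast
    fix z assume z: "z \<in> ?A"
    show "limit_set z \<subseteq> ?A"
    proof (intro Int_greatest INT_greatest)
      show "limit_set z \<subseteq> C"
        using z C by (auto simp: stable_def)
      fix x and \<eta> :: real assume x: "x \<in> X" and "\<eta> \<in> {0<..}"
      then have "0 < \<eta> / 2"
        by simp
      \<comment> \<open>One half of \<eta> is used for the membership of \<open>z\<close>, the other
        is the loss in \<open>limit_set_near\<close>.\<close>
      have "limit_set z \<subseteq> {z \<in> topspace T. near r j (c + \<eta> / 2 + \<eta> / 2) z x}"
        using z CT j(2) n x \<open>0 < \<eta> / 2\<close> by (intro limit_set_near[OF XT image bounded]) auto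
      moreover have "c + \<eta> / 2 + \<eta> / 2 = c + \<eta>"
        by simp
      ultimately show "limit_set z \<subseteq> {z \<in> topspace T. near r j (c + \<eta>) z x}"
        by (simp only:)
    qed
  qed
  \<comment> \<open>As \<open>X\<close> lies in \<open>C\<close>, all pairs in \<open>X\<close> are
    now joined in \<open>j\<close> steps, against the choice of \<open>k\<close> as least.\<close>
  then have "?A = C"
    using minimal by blast
  then have "near r j (c + \<eta>) z x" if "z \<in> X" "x \<in> X" "0 < \<eta>" for z x \<eta>
    using that X(2) by blast
  then have "P j"
    using j(2) n unfolding P_def by simp
  then show False
    using least j(1) by blast
qed

text \<open>A minimal invariant set inside the limit set of a point of \<open>C\<close> lies in
  \<open>C\<close> by stability. It is therefore a singleton, and invariance makes its point
  fixed.\<close>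

lemma common_fixed_point:
  assumes ne: "topspace T \<noteq> {}"
    and m: "\<exists>m :: ('s \<Rightarrow>\<^sub>C real) \<Rightarrow> real. left_invariant_mean m"
    and Q: "countable Q" "Q \<subseteq> topspace T" "\<And>x e. x \<in> topspace T \<Longrightarrow> e > 0 \<Longrightarrow> \<exists>q\<in>Q. d q x < e"
  shows "\<exists>x\<in>topspace T. \<forall>s. act s x = x"
proof -
  obtain C where C: "stable C" "\<And>A. stable A \<Longrightarrow> A \<subseteq> C \<Longrightarrow> A = C"
    using minimal_stable_exists[OF ne] by blast
  then obtain z where z: "z \<in> C" "z \<in> topspace T"
    using closedin_subset unfolding stable_def by blast
  obtain X where X: "minimal_invariant X" "X \<subseteq> limit_set z"
    using minimal_invariant_exists[OF closedin_limit_set limit_set_nonempty[OF z(2)] invariant_limit_set[OF z(2)]]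
    by blast
  have "X \<noteq> {}" and inv: "invariant X" and XT: "X \<subseteq> topspace T"
    using X(1) closedin_subset by (auto simp: minimal_invariant_def)
  have XC: "X \<subseteq> C"
    using X(2) z(1) C(1) by (auto simp: stable_def)
  have image: "act s ` X = X" for s
    by (rule minimal_invariant_image[OF m X(1)])
  have bounded: "\<exists>F. finite F \<and> F \<subseteq> X \<and> (\<forall>x\<in>X. \<exists>y\<in>F. d y x \<le> e)" if "e > 0" for e
  proof -
    have "\<exists>q\<in>Q. d q x < e" if "x \<in> X" "e > 0" for x e
      using Q(3) that XT by blast
    from minimal_invariant_totally_bounded[OF X(1) image Q(1,2) this that] show ?thesis .
  qed
  obtain x where x: "x \<in> X"
    using \<open>X \<noteq> {}\<close> by blast
  have "act s x = x" for s
    using minimal_invariant_singleton[OF \<open>X \<noteq> {}\<close> XC image bounded C] x inv unfolding invariant_def by blast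
  then show ?thesis
    using x XT by blast
qed

end

subsection \<open>Fixed points in Frechet spaces\<close>

lemma closedin_admissible_dist_le:
  assumes "admissible d \<tau>"
  shows "closedin (prod_topology \<tau> \<tau>) {z \<in> topspace (prod_topology \<tau> \<tau>). d (fst z) (snd z) \<le> c}"
proof -
  have "openin (prod_topology \<tau> \<tau>) {z \<in> topspace (prod_topology \<tau> \<tau>). c < d (fst z) (snd z)}"
    using assms by (simp add: admissible_def lower_semicontinuous_def case_prod_beta)
  then have "closedin (prod_topology \<tau> \<tau>)
      (topspace (prod_topology \<tau> \<tau>) - {z \<in> topspace (prod_topology \<tau> \<tau>). c < d (fst z) (snd z)})"
    by blast
  also have "topspace (prod_topology \<tau> \<tau>) - {z \<in> topspace (prod_topology \<tau> \<tau>). c < d (fst z) (snd z)}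
      = {z \<in> topspace (prod_topology \<tau> \<tau>). d (fst z) (snd z) \<le> c}"
    by auto
  finally show ?thesis .
qed

lemma locally_convex_topology_affine:
  assumes "locally_convex_topology \<tau>"
  shows "continuous_map \<tau> \<tau> (\<lambda>w. a *\<^sub>R (x - w))"
proof -
  have top: "topspace \<tau> = UNIV"
    and add: "continuous_map (prod_topology \<tau> \<tau>) \<tau> (\<lambda>(x, y). x + y)"
    and scale: "continuous_map (prod_topology euclideanreal \<tau>) \<tau> (\<lambda>(c, x). c *\<^sub>R x)"
    using assms by (auto simp: locally_convex_topology_def)
  have "continuous_map \<tau> (prod_topology euclideanreal \<tau>) (\<lambda>w. (- a, w))"
    by (intro continuous_map_pairedI) auto
  from continuous_map_compose[OF this scale] have "continuous_map \<tau> \<tau> (\<lambda>w. (- a) *\<^sub>R w)"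
    by (simp add: o_def)
  then have "continuous_map \<tau> (prod_topology \<tau> \<tau>) (\<lambda>w. (a *\<^sub>R x, (- a) *\<^sub>R w))"
    using top by (intro continuous_map_pairedI) auto
  from continuous_map_compose[OF this add] show ?thesis
    by (simp add: o_def scaleR_diff_right)
qed

theorem theorem2p2:
  fixes d :: "'x::real_vector \<Rightarrow> 'x \<Rightarrow> real"
    and \<tau> :: "'x topology"
    and K :: "'x set"
    and act :: "'s::semitopological_semigroup \<Rightarrow> 'x \<Rightarrow> 'x"
  assumes "right_reversible TYPE('s)"
    and "\<exists>m :: ('s \<Rightarrow>\<^sub>C real) \<Rightarrow> real. left_invariant_mean m"
    and "Frechet_space d"
    and "good_metric d"
    and "locally_convex_topology \<tau>"
    and "admissible d \<tau>"
    and "K \<noteq> {}"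
    and "separable_space (subtopology (metric_topology d) K)"
    and "compactin \<tau> K"
    and "convex K"
    and "semigroup_action K act"
    and "super_asymptotically_nonexpansive d K act"
    and "jointly_continuous_action \<tau> K act"
  shows "\<exists>x0\<in>K. \<forall>s. act s x0 = x0"
proof -
  have metric: "Metric_space UNIV d" and lct: "locally_convex_topology (metric_topology d)"
    using assms(3) by (auto simp: Frechet_space_def)
  have top: "topspace \<tau> = UNIV"
    using assms(5) by (simp add: locally_convex_topology_def)
  let ?T = "subtopology \<tau> K"
  have topT: "topspace ?T = K"
    by (simp add: top)
  have closed_dist: "closedin (prod_topology ?T ?T) {z \<in> K \<times> K. d (fst z) (snd z) \<le> c}" for c
  proof -
    have "closedin (subtopology (prod_topology \<tau> \<tau>) (K \<times> K))
        ({z \<in> topspace (prod_topology \<tau> \<tau>). d (fst z) (snd z) \<le> c} \<inter> (K \<times> K))"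
      using closedin_admissible_dist_le[OF assms(6)] by (auto simp: closedin_subtopology)
    also have "{z \<in> topspace (prod_topology \<tau> \<tau>). d (fst z) (snd z) \<le> c} \<inter> (K \<times> K)
        = {z \<in> K \<times> K. d (fst z) (snd z) \<le> c}"
      by (auto simp: top)
    finally show ?thesis
      by (simp add: subtopology_Times)
  qed
  have closed_scaled: "closedin ?T {w \<in> K. d (a *\<^sub>R (x - w)) 0 \<le> c}" for a x c
  proof -
    \<comment> \<open>Pairing with 0 turns lower semicontinuity of \<open>d\<close> in two variables
      into closedness of a set in the single variable \<open>w\<close>.\<close>
    have "continuous_map \<tau> (prod_topology \<tau> \<tau>) (\<lambda>w. (a *\<^sub>R (x - w), 0))"
      using assms(5) top by (intro continuous_map_pairedI locally_convex_topology_affine) auto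
    from closedin_continuous_map_preimage[OF this closedin_admissible_dist_le[OF assms(6)]]
    have "closedin \<tau> {w. d (a *\<^sub>R (x - w)) 0 \<le> c}"
      by (simp add: top)
    then have "closedin ?T ({w. d (a *\<^sub>R (x - w)) 0 \<le> c} \<inter> K)"
      by (auto simp: closedin_subtopology)
    also have "{w. d (a *\<^sub>R (x - w)) 0 \<le> c} \<inter> K = {w \<in> K. d (a *\<^sub>R (x - w)) 0 \<le> c}"
      by auto
    finally show ?thesis .
  qed
  interpret convex_nonexpansive_action ?T act d
  proof (intro convex_nonexpansive_action.intro nonexpansive_action.intro compact_semigroup_action.intro
      nonexpansive_action_axioms.intro convex_nonexpansive_action_axioms.intro, unfold topT)
    show "compact_space ?T"
      using assms(9) by (simp add: compactin_subspace)
    show "Hausdorff_space ?T"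
      using assms(5) by (simp add: locally_convex_topology_def Hausdorff_space_subtopology)
    show "act (s * t) x = act s (act t x)" if "x \<in> K" for s t x
      using assms(11) that by (simp add: semigroup_action_def)
    show "continuous_map (prod_topology euclidean ?T) ?T (\<lambda>(s, x). act s x)"
      using assms(13) by (simp add: jointly_continuous_action_def)
    show "Metric_space K d"
      using metric by (rule Metric_space.subspace) simp
    show "\<exists>k>0. d ((1 / real k) *\<^sub>R v) 0 < e" if "0 < e" for e v
      by (rule good_metric_divide_small[OF metric assms(4) lct that])
  qed (fact closed_dist closed_scaled assms metric)+
  \<comment> \<open>Density here is for the \<open>d\<close>-topology, as the covering by
    \<open>d\<close>-balls in the Baire argument requires, while compactness and closedness refer to
    \<tau>.\<close>
  obtain Q where Q: "countable Q" "Q \<subseteq> K" "subtopology (metric_topology d) K closure_of Q = K"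
    using assms(8) Metric_space.topspace_mtopology[OF metric] by (auto simp: separable_space_def)
  have "\<exists>q\<in>Q. d q x < e" if x: "x \<in> K" and e: "0 < e" for x e
  proof -
    have "openin (subtopology (metric_topology d) K) (Metric_space.mball UNIV d x e \<inter> K)"
      using Metric_space.openin_mball[OF metric] by (auto simp: openin_subtopology)
    moreover have "x \<in> Metric_space.mball UNIV d x e \<inter> K"
      using x e Metric_space.centre_in_mball_iff[OF metric] by simp
    moreover have "x \<in> subtopology (metric_topology d) K closure_of Q"
      using x Q(3) by simp
    ultimately obtain q where q: "q \<in> Q" "q \<in> Metric_space.mball UNIV d x e"
      unfolding in_closure_of by blast
    have "d q x < e"
      using q(2) by (simp add: Metric_space.in_mball[OF metric] Metric_space.commute[OF metric, of q])
    then show ?thesis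
      using q(1) by blast
  qed
  then show ?thesis
    using common_fixed_point[unfolded topT, OF assms(7,2) Q(1,2)] by blast
qed

end
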